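(* Assume Case 2 holds and $d>0$. Then: (1) if $l_1\le1$, then $c(Q^n)=\gamma_n+d^n$ for all $n\ge1$; (2) if $l_1>1$, then $l_1^{-1}\gamma_n+d^n\le c(Q^n)<\gamma_n+d^n$ for all $n\ge1$; (3) if $l_1>1$ and ($n_1>0$ or $s>2$), then $l_1^{-1}\gamma_n+d^n<c(Q^n)$ for all $n\ge1$. Suppose further that $l_1>1$, $n_1=0$ and $s=2$. Then: (4) if $\delta<T_{s-1}$, then $l_1^{-1}\gamma+d=c(q)$ and $l_1^{-1}\gamma_n+d^n<c(Q^n)$ for all $n\ge2$; (5) if $\delta=T_{s-1}$, then $l_1^{-1}\gamma_n+d^n=c(Q^n)$ for all $n\ge1$.
   Context: Let $f(z,w)=(p(z),q(z,w))$ be a holomorphic skew product germ at the origin of $\mathbb{C}^2$ with $f(0,0)=(0,0)$, where $p(z)=a_\delta z^\delta+O(z^{\delta+1})$ with $a_\delta\neq0$ and integer $\delta\ge1$, and $q(z,w)=\sum_{i+j\ge1}b_{ij}z^iw^j$ is not identically zero. For $n\ge1$ write $f^n=(p^n,Q^n)$. For a nonzero germ $g=\sum g_{ij}z^iw^j$ let $c(g)=\min\{i+j:g_{ij}\neq0\}$. The Newton polygon $N(g)$ is the convex hull of $\bigcup_{g_{ij}\neq0}\{(x,y):x\ge i,\ y\ge j\}$. Let $(n_1,m_1),\dots,(n_s,m_s)$ be the vertices of $N(q)$ with $n_1<\cdots<n_s$, $m_1>\cdots>m_s$; for $1\le k\le s-1$ let $T_k$ be the $y$-intercept of the line through $(n_k,m_k)$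 and $(n_{k+1},m_{k+1})$. Case 2 means: $s>1$ and $\delta\le T_{s-1}$; set $(\gamma,d)=(n_s,m_s)$ and $l_1=\frac{n_s-n_{s-1}}{m_{s-1}-m_s}$. Define $\gamma_n=\gamma(\delta^{n-1}+\delta^{n-2}d+\cdots+d^{n-1})$. *)

theory Defs
  imports "HOL-Analysis.Analysis"
begin

definition expansion1 :: "(complex \<Rightarrow> complex) \<Rightarrow> (nat \<Rightarrow> complex) \<Rightarrow> real \<Rightarrow> bool" where
  "expansion1 g a r \<longleftrightarrow> r > 0 \<and>
     (\<forall>z. norm z < r \<longrightarrow> ((\<lambda>k. a k * z ^ k) has_sum g z) UNIV)"

definition expansion2 :: "(complex \<Rightarrow> complex \<Rightarrow> complex) \<Rightarrow> (nat \<Rightarrow> nat \<Rightarrow> complex) \<Rightarrow> real \<Rightarrow> bool" where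
  "expansion2 g a r \<longleftrightarrow> r > 0 \<and>
     (\<forall>z w. norm z < r \<and> norm w < r \<longrightarrow>
        ((\<lambda>(i, j). a i j * z ^ i * w ^ j) has_sum g z w) UNIV)"

text \<open>Taylor coefficients of a two-variable germ (unique when an expansion exists).\<close>
definition coeffs2 :: "(complex \<Rightarrow> complex \<Rightarrow> complex) \<Rightarrow> nat \<Rightarrow> nat \<Rightarrow> complex" where
  "coeffs2 g = (SOME a. \<exists>r. expansion2 g a r)"

definition ord2 :: "(complex \<Rightarrow> complex \<Rightarrow> complex) \<Rightarrow> nat" where
  "ord2 g = (LEAST k. \<exists>i j. i + j = k \<and> coeffs2 g i j \<noteq> 0)"

definition newton_polygon :: "(nat \<Rightarrow> nat \<Rightarrow> complex) \<Rightarrow> (real \<times> real) set" where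
  "newton_polygon b = convex hull
     (\<Union>(i, j) \<in> {(i, j). b i j \<noteq> 0}. {(x, y). x \<ge> real i \<and> y \<ge> real j})"

definition y_intercept :: "real \<Rightarrow> real \<Rightarrow> real \<Rightarrow> real \<Rightarrow> real" where
  "y_intercept x1 y1 x2 y2 = y1 - (y2 - y1) / (x2 - x1) * x1"

definition skew :: "(complex \<Rightarrow> complex) \<Rightarrow> (complex \<Rightarrow> complex \<Rightarrow> complex) \<Rightarrow> complex \<times> complex \<Rightarrow> complex \<times> complex" where
  "skew p q = (\<lambda>(z, w). (p z, q z w))"

definition Qn :: "(complex \<Rightarrow> complex) \<Rightarrow> (complex \<Rightarrow> complex \<Rightarrow> complex) \<Rightarrow> nat \<Rightarrow> complex \<Rightarrow> complex \<Rightarrow> complex" where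
  "Qn p q n = (\<lambda>z w. snd ((skew p q ^^ n) (z, w)))"

definition gamma_n :: "nat \<Rightarrow> nat \<Rightarrow> nat \<Rightarrow> nat \<Rightarrow> nat" where
  "gamma_n \<gamma> \<delta> d n = \<gamma> * (\<Sum>k<n. \<delta> ^ (n - 1 - k) * d ^ k)"

end

theory Submission
  imports Defs
begin

text \<open>
  Let \<open>A\<close>, \<open>B\<close> be the width and height of the last edge of the Newton polygon of \<open>q\<close>, so \<open>l\<^sub>1 = A / B\<close>, and
  give \<open>z\<^sup>i w\<^sup>j\<close> the weight \<open>B i + A j\<close>. Substituting \<open>(p, q)\<close> turns a monomial of weight \<open>N\<close> into a
  series of lowest weight \<open>\<delta> N + D j\<close> with \<open>D = A (T - \<delta>) \<ge> 0\<close>. Inductively, \<open>(\<gamma>\<^sub>n, d\<^sup>n)\<close> has the least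
  \<open>w\<close>-exponent and the least weight in the support of \<open>Q\<^sup>n\<close>. The order \<open>c(Q\<^sup>n)\<close> is then read off from
  the two ends of the edge of least weight: \<open>(\<gamma>\<^sub>n, d\<^sup>n)\<close> and an upper end \<open>(I, J)\<close> with \<open>J > d\<^sup>n\<close>. The weight
  bound is attained exactly if \<open>I = 0\<close>. The upper end of \<open>Q\<^sup>n\<^sup>+\<^sup>1\<close> comes from the upper end of \<open>Q\<^sup>n\<close> if
  \<open>D = 0\<close>, and from \<open>(\<gamma>\<^sub>n, d\<^sup>n)\<close> if \<open>D > 0\<close>.
\<close>

no_notation Infinite_Set_Sum.abs_summable_on (infix \<open>abs'_summable'_on\<close> 50)

section \<open>Cauchy products of double series\<close>

text \<open>Families of coefficients live on exponent pairs, where multiplying monomials is adding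
  pairs. The coefficient type stays general because real norms are convolved as well as complex
  coefficients.\<close>

definition dconv :: "(nat \<times> nat \<Rightarrow> 'a::comm_semiring_1) \<Rightarrow> (nat \<times> nat \<Rightarrow> 'a) \<Rightarrow> nat \<times> nat \<Rightarrow> 'a" where
  "dconv F G v = (\<Sum>(u, u')\<in>{(u, u'). u + u' = v}. F u * G u')"

primrec dpow :: "(nat \<times> nat \<Rightarrow> 'a::comm_semiring_1) \<Rightarrow> nat \<Rightarrow> nat \<times> nat \<Rightarrow> 'a" where
  "dpow F 0 = (\<lambda>v. if v = 0 then 1 else 0)"
| "dpow F (Suc k) = dconv F (dpow F k)"

text \<open>For \<open>u = (i, j)\<close>, the coefficients of z^i w^j after \<open>P\<close> is
  substituted for z and \<open>Q\<close> for w.\<close>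

definition dmon :: "(nat \<times> nat \<Rightarrow> 'a::comm_semiring_1) \<Rightarrow> (nat \<times> nat \<Rightarrow> 'a) \<Rightarrow> nat \<times> nat \<Rightarrow> nat \<times> nat \<Rightarrow> 'a" where
  "dmon P Q u = dconv (dpow P (fst u)) (dpow Q (snd u))"

text \<open>Summing over \<open>u\<close> with \<open>infsum\<close> avoids any finiteness argument;
  that the values are the coefficients of the composite is shown under absolute convergence in
  \<open>expansion2_dcomp\<close>.\<close>

definition dcomp :: "(nat \<times> nat \<Rightarrow> complex) \<Rightarrow> (nat \<times> nat \<Rightarrow> complex) \<Rightarrow> (nat \<times> nat \<Rightarrow> complex)
    \<Rightarrow> nat \<times> nat \<Rightarrow> complex" where
  "dcomp C P Q v = (\<Sum>\<^sub>\<infinity>u. C u * dmon P Q u v)"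

lemma finite_antidiagonal: "finite {(u, u'). u + u' = (v :: nat \<times> nat)}"
proof (rule finite_subset)
  show "{(u, u'). u + u' = v} \<subseteq> ({..fst v} \<times> {..snd v}) \<times> ({..fst v} \<times> {..snd v})"
    by auto
qed auto

text \<open>Used for two multiplicative functions of the exponent: the weight t^(i+j) of a majorant
  and the evaluation monomial z^i w^j.\<close>

lemma dconv_mult_multiplicative:
  assumes "\<And>u u'. \<mu> (u + u') = \<mu> u * \<mu> u'"
  shows "dconv (\<lambda>u. F u * \<mu> u) (\<lambda>u. G u * \<mu> u) v = dconv F G v * \<mu> v"
  unfolding dconv_def sum_distrib_right
  by (rule sum.cong) (auto simp: assms mult_ac simp del: add_Pair)

text \<open>The products form an absolutely summable family over all pairs. Summed row by row it
  gives \<open>a * b\<close>; regrouped by the sum of the two exponents it gives the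
  convolution.\<close>

lemma has_sum_dconv:
  fixes f g :: "nat \<times> nat \<Rightarrow> 'a::{banach,real_normed_field}"
  assumes f: "f abs_summable_on UNIV" "(f has_sum a) UNIV"
    and g: "g abs_summable_on UNIV" "(g has_sum b) UNIV"
  shows "(dconv f g has_sum (a * b)) UNIV"
proof -
  let ?h = "\<lambda>(u, v). f u * g v"
  have "?h abs_summable_on UNIV \<times> UNIV"
    unfolding Infinite_Sum.abs_summable_on_Sigma_iff
  proof (intro conjI ballI)
    fix u show "(\<lambda>y. ?h (u, y)) abs_summable_on UNIV"
      using g(1) by (auto simp: norm_mult intro: summable_on_cmult_right)
  next
    have "(\<lambda>u. norm (f u) * (\<Sum>\<^sub>\<infinity>v. norm (g v))) summable_on UNIV"
      by (intro summable_on_cmult_left f)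
    moreover have "(\<Sum>\<^sub>\<infinity>v. norm (g v)) \<ge> 0"
      by (intro infsum_nonneg) auto
    ultimately show "(\<lambda>x. infsum (\<lambda>y. norm (?h (x, y))) UNIV) abs_summable_on UNIV"
      using g(1) by (simp add: norm_mult infsum_cmult_right' abs_mult)
  qed
  then have "?h summable_on UNIV \<times> UNIV"
    by (rule Infinite_Sum.abs_summable_summable)
  moreover have "((\<lambda>v. ?h (u, v)) has_sum (f u * b)) UNIV" for u
    using has_sum_cmult_right[OF g(2)] by simp
  ultimately have "(?h has_sum (a * b)) (UNIV \<times> UNIV)"
    by (rule has_sum_SigmaI[rotated 2]) (use has_sum_cmult_left[OF f(2)] in auto)
  \<comment> \<open>Every pair of exponents lies on exactly one antidiagonal.\<close>
  moreover have "bij_betw snd (SIGMA v:UNIV. {(u, u'). u + u' = v}) (UNIV \<times> UNIV)"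
    by (rule bij_betw_byWitness[where f' = "\<lambda>(u, u'). (u + u', (u, u'))"]) auto
  ultimately have "((\<lambda>x. ?h (snd x)) has_sum (a * b)) (SIGMA v:UNIV. {(u, u'). u + u' = v})"
    using has_sum_reindex_bij_betw[of snd _ _ ?h] by blast
  then show ?thesis
    unfolding dconv_def
    by (rule has_sum_SigmaD) (use has_sum_finite[OF finite_antidiagonal] in auto)
qed

text \<open>A bound on the weighted l^1 norm of \<open>F\<close> at radius \<open>t\<close>.
  Summability is demanded separately because \<open>infsum\<close> is 0 on families that are not
  summable.\<close>

definition majorised :: "(nat \<times> nat \<Rightarrow> complex) \<Rightarrow> real \<Rightarrow> real \<Rightarrow> bool" where
  "majorised F t M \<longleftrightarrow> (\<lambda>u. norm (F u) * t ^ (fst u + snd u)) summable_on UNIV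
     \<and> (\<Sum>\<^sub>\<infinity>u. norm (F u) * t ^ (fst u + snd u)) \<le> M"

text \<open>The weighted l^1 norm is submultiplicative: the convolution of the norms dominates
  termwise, and its sum is the product of the two sums.\<close>

lemma majorised_dconv:
  assumes F: "majorised F t M" and G: "majorised G t M'" and t: "t \<ge> 0"
  shows "majorised (dconv F G) t (M * M')"
proof -
  define f where "f = (\<lambda>u. norm (F u) * t ^ (fst u + snd u))"
  define g where "g = (\<lambda>u. norm (G u) * t ^ (fst u + snd u))"
  have nn: "f u \<ge> 0" "g u \<ge> 0" for u using t by (auto simp: f_def g_def)
  have s: "f summable_on UNIV" "g summable_on UNIV" "infsum f UNIV \<le> M" "infsum g UNIV \<le> M'"
    using F G by (auto simp: majorised_def f_def g_def)
  have fg: "(dconv f g has_sum (infsum f UNIV * infsum g UNIV)) UNIV"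
    using s nn by (intro has_sum_dconv) auto
  have le: "norm (dconv F G v) * t ^ (fst v + snd v) \<le> dconv f g v" for v
  proof -
    have "norm (dconv F G v) \<le> dconv (\<lambda>u. norm (F u)) (\<lambda>u. norm (G u)) v"
      unfolding dconv_def by (rule sum_norm_le) (auto simp: norm_mult)
    then have "norm (dconv F G v) * t ^ (fst v + snd v)
        \<le> dconv (\<lambda>u. norm (F u)) (\<lambda>u. norm (G u)) v * t ^ (fst v + snd v)"
      using t by (intro mult_right_mono) auto
    also have "\<dots> = dconv f g v"
      unfolding f_def g_def
      by (rule dconv_mult_multiplicative[symmetric]) (auto simp: power_add mult_ac)
    finally show ?thesis .
  qed
  have sm: "(\<lambda>v. norm (dconv F G v) * t ^ (fst v + snd v)) summable_on UNIV"
    using le t by (intro summable_on_comparison_test[OF has_sum_imp_summable[OF fg]]) auto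
  have "(\<Sum>\<^sub>\<infinity>v. norm (dconv F G v) * t ^ (fst v + snd v)) \<le> infsum (dconv f g) UNIV"
    using sm le has_sum_imp_summable[OF fg] by (intro infsum_mono) auto
  also have "\<dots> = infsum f UNIV * infsum g UNIV"
    using fg by (rule infsumI)
  also have "\<dots> \<le> M * M'"
    using s nn by (intro mult_mono) (auto intro!: infsum_nonneg order_trans[OF infsum_nonneg s(3)])
  finally show ?thesis using sm by (simp add: majorised_def)
qed

lemma has_sum_unit: "((\<lambda>u. (if u = 0 then 1 else 0) * \<mu> u) has_sum \<mu> 0) UNIV"
  for \<mu> :: "nat \<times> nat \<Rightarrow> 'a::{banach,real_normed_field}"
  by (rule has_sum_finite_neutralI[of "{0}"]) auto

lemma majorised_dpow:
  assumes F: "majorised F t M" and t: "t \<ge> 0"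
  shows "majorised (dpow F k) t (M ^ k)"
proof (induction k)
  case 0
  have "((\<lambda>u. norm (dpow F 0 u) * t ^ (fst u + snd u)) has_sum 1) UNIV"
    using has_sum_unit[of "\<lambda>u. t ^ (fst u + snd u)"] by (simp add: if_distrib cong: if_cong)
  then show ?case
    by (auto simp: majorised_def has_sum_imp_summable infsumI)
next
  case (Suc k)
  then show ?case using majorised_dconv[OF F Suc t] by simp
qed

lemma majorised_imp_abs_summable:
  assumes "majorised F t M" "norm z \<le> t" "norm w \<le> t"
  shows "(\<lambda>u. F u * (z ^ fst u * w ^ snd u)) abs_summable_on UNIV"
    and "(\<Sum>\<^sub>\<infinity>u. norm (F u * (z ^ fst u * w ^ snd u))) \<le> M"
proof -
  have t: "t \<ge> 0" using assms(2) norm_ge_zero order_trans by blast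
  have le: "norm (F u * (z ^ fst u * w ^ snd u)) \<le> norm (F u) * t ^ (fst u + snd u)" for u
    using assms(2,3) t unfolding norm_mult norm_power power_add
    by (intro mult_left_mono mult_mono power_mono) auto
  have s: "(\<lambda>u. norm (F u) * t ^ (fst u + snd u)) summable_on UNIV"
    using assms by (auto simp: majorised_def)
  show 1: "(\<lambda>u. F u * (z ^ fst u * w ^ snd u)) abs_summable_on UNIV"
    using s le by (rule summable_on_comparison_test) auto
  have "(\<Sum>\<^sub>\<infinity>u. norm (F u * (z ^ fst u * w ^ snd u))) \<le> (\<Sum>\<^sub>\<infinity>u. norm (F u) * t ^ (fst u + snd u))"
    using 1 s le by (rule infsum_mono)
  then show "(\<Sum>\<^sub>\<infinity>u. norm (F u * (z ^ fst u * w ^ snd u))) \<le> M"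
    using assms by (auto simp: majorised_def)
qed

lemma has_sum_dconv_eval:
  assumes F: "majorised F t M" "((\<lambda>u. F u * (z ^ fst u * w ^ snd u)) has_sum x) UNIV"
    and G: "majorised G t M'" "((\<lambda>u. G u * (z ^ fst u * w ^ snd u)) has_sum y) UNIV"
    and zw: "norm z \<le> t" "norm w \<le> t"
  shows "((\<lambda>u. dconv F G u * (z ^ fst u * w ^ snd u)) has_sum (x * y)) UNIV"
proof -
  have "dconv F G u * (z ^ fst u * w ^ snd u)
      = dconv (\<lambda>u. F u * (z ^ fst u * w ^ snd u)) (\<lambda>u. G u * (z ^ fst u * w ^ snd u)) u" for u
    by (rule dconv_mult_multiplicative[symmetric]) (auto simp: power_add mult_ac)
  then show ?thesis
    using has_sum_dconv[OF majorised_imp_abs_summable(1)[OF F(1) zw] F(2)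
        majorised_imp_abs_summable(1)[OF G(1) zw] G(2)] by simp
qed

lemma has_sum_dpow_eval:
  assumes F: "majorised F t M" "((\<lambda>u. F u * (z ^ fst u * w ^ snd u)) has_sum x) UNIV"
    and zw: "norm z \<le> t" "norm w \<le> t"
  shows "((\<lambda>u. dpow F k u * (z ^ fst u * w ^ snd u)) has_sum (x ^ k)) UNIV"
proof (induction k)
  case 0
  show ?case using has_sum_unit[of "\<lambda>u. z ^ fst u * w ^ snd u"] by simp
next
  case (Suc k)
  have "t \<ge> 0" using zw norm_ge_zero order_trans by blast
  then show ?case
    using has_sum_dconv_eval[OF F majorised_dpow[OF F(1)] Suc zw] by simp
qed

section \<open>Substitution of convergent double series\<close>

lemma expansion2_iff:
  "expansion2 g (curry F) r \<longleftrightarrow> r > 0 \<and> (\<forall>z w. norm z < r \<and> norm w < r \<longrightarrow>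
     ((\<lambda>u. F u * (z ^ fst u * w ^ snd u)) has_sum g z w) UNIV)"
  by (simp add: expansion2_def case_prod_unfold mult.assoc)

text \<open>The monomial \<open>u\<close> substituted has norm at most M^(i+j), so the outer
  coefficients weighted by these powers dominate the double family over \<open>(u, v)\<close>.
  Fubini then allows summing over \<open>v\<close> first, which evaluates the composite, or over
  \<open>u\<close> first, which yields \<open>dcomp\<close>.\<close>

lemma expansion2_dcomp:
  assumes C: "expansion2 G (curry C) r" and t: "t > 0" and M: "M < r"
    and P: "majorised P t M" "expansion2 p (curry P) r1" "t \<le> r1"
    and Q: "majorised Q t M" "expansion2 q (curry Q) r2" "t \<le> r2"
  shows "expansion2 (\<lambda>z w. G (p z w) (q z w)) (curry (dcomp C P Q)) t"
  unfolding expansion2_iff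
proof (intro conjI allI impI)
  fix z w :: complex assume zw: "norm z < t \<and> norm w < t"
  then have zw': "norm z \<le> t" "norm w \<le> t" by auto
  define \<mu> :: "nat \<times> nat \<Rightarrow> complex" where "\<mu> u = z ^ fst u * w ^ snd u" for u
  define x where "x = p z w"
  define y where "y = q z w"
  have hx: "((\<lambda>u. P u * \<mu> u) has_sum x) UNIV" and hy: "((\<lambda>u. Q u * \<mu> u) has_sum y) UNIV"
    using P(2,3) Q(2,3) zw unfolding expansion2_iff \<mu>_def x_def y_def by auto
  \<comment> \<open>Values are bounded by the weighted norm, so \<open>(x, y)\<close> stays in the
    polydisc where the outer expansion converges.\<close>
  have small: "norm c \<le> M" if "majorised F t M" "((\<lambda>u. F u * \<mu> u) has_sum c) UNIV" for F c
  proof -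
    note a = majorised_imp_abs_summable[OF that(1) zw', folded \<mu>_def]
    have "norm c = norm (infsum (\<lambda>u. F u * \<mu> u) UNIV)" using infsumI[OF that(2)] by simp
    also have "\<dots> \<le> (\<Sum>\<^sub>\<infinity>u. norm (F u * \<mu> u))" by (rule norm_infsum_bound) (rule a(1))
    finally show ?thesis using a(2) by simp
  qed
  have xy: "norm x \<le> M" "norm y \<le> M" using small[OF P(1) hx] small[OF Q(1) hy] by auto
  then have M0: "M \<ge> 0" using norm_ge_zero order_trans by blast
  have mon_maj: "majorised (dmon P Q u) t (M ^ (fst u + snd u))" for u
    unfolding dmon_def power_add
    using t by (intro majorised_dconv majorised_dpow P(1) Q(1)) auto
  have mon_sum: "((\<lambda>v. dmon P Q u v * \<mu> v) has_sum (x ^ fst u * y ^ snd u)) UNIV" for u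
    unfolding dmon_def \<mu>_def
    by (rule has_sum_dconv_eval[OF majorised_dpow[OF P(1)] has_sum_dpow_eval[OF P(1) hx[unfolded \<mu>_def] zw']
          majorised_dpow[OF Q(1)] has_sum_dpow_eval[OF Q(1) hy[unfolded \<mu>_def] zw'] zw'])
      (use t in auto)
  define \<Phi> where "\<Phi> = (\<lambda>(u, v). C u * (dmon P Q u v * \<mu> v))"
  \<comment> \<open>Since \<open>M < r\<close>, the outer series converges at the point
    \<open>(M, M)\<close>, and unconditional convergence over the complex numbers is
    absolute.\<close>
  have Csum: "(\<lambda>u. norm (C u) * M ^ (fst u + snd u)) summable_on UNIV"
  proof -
    have "((\<lambda>u. C u * (of_real M ^ fst u * of_real M ^ snd u)) has_sum G (of_real M) (of_real M)) UNIV"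
      using C M M0 unfolding expansion2_iff by auto
    then have "(\<lambda>u. C u * (of_real M ^ fst u * of_real M ^ snd u)) abs_summable_on UNIV"
      by (rule summable_on_iff_abs_summable_on_complex[THEN iffD1, OF has_sum_imp_summable])
    then show ?thesis using M0 by (simp add: norm_mult norm_power power_add)
  qed
  have "\<Phi> abs_summable_on UNIV \<times> UNIV"
    unfolding Infinite_Sum.abs_summable_on_Sigma_iff
  proof (intro conjI ballI)
    note a = majorised_imp_abs_summable[OF mon_maj zw', folded \<mu>_def]
    fix u show "(\<lambda>v. \<Phi> (u, v)) abs_summable_on UNIV"
      unfolding \<Phi>_def using a(1)[of u]
      by (simp add: norm_mult[of "C u"] summable_on_cmult_right)
  next
    note a = majorised_imp_abs_summable[OF mon_maj zw', folded \<mu>_def]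
    have eq: "(\<Sum>\<^sub>\<infinity>v. norm (\<Phi> (u, v))) = norm (C u) * (\<Sum>\<^sub>\<infinity>v. norm (dmon P Q u v * \<mu> v))" for u
      unfolding \<Phi>_def by (simp add: norm_mult[of "C u"] infsum_cmult_right')
    show "(\<lambda>u. \<Sum>\<^sub>\<infinity>v. norm (\<Phi> (u, v))) abs_summable_on UNIV"
    proof (rule summable_on_comparison_test[OF Csum])
      fix u :: "nat \<times> nat"
      have "(\<Sum>\<^sub>\<infinity>v. norm (\<Phi> (u, v))) \<ge> 0" by (intro infsum_nonneg) auto
      then show "norm (\<Sum>\<^sub>\<infinity>v. norm (\<Phi> (u, v))) \<le> norm (C u) * M ^ (fst u + snd u)"
        using a(2)[of u] by (simp add: eq mult_left_mono)
    qed auto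
  qed
  then have sm: "\<Phi> summable_on UNIV \<times> UNIV" by (rule Infinite_Sum.abs_summable_summable)
  have "((\<lambda>v. \<Phi> (u, v)) has_sum (C u * (x ^ fst u * y ^ snd u))) UNIV" for u
    unfolding \<Phi>_def using has_sum_cmult_right[OF mon_sum] by simp
  moreover have "((\<lambda>u. C u * (x ^ fst u * y ^ snd u)) has_sum G x y) UNIV"
    using C xy M unfolding expansion2_iff by auto
  ultimately have tot: "(\<Phi> has_sum G x y) (UNIV \<times> UNIV)"
    using sm by (intro has_sum_SigmaI) auto
  then have tot': "((\<lambda>(v, u). \<Phi> (u, v)) has_sum G x y) (UNIV \<times> UNIV)"
    by (subst (asm) has_sum_swap)
  have "((\<lambda>v. dcomp C P Q v * \<mu> v) has_sum G x y) UNIV"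
  proof (rule has_sum_SigmaD[OF tot'])
    fix v :: "nat \<times> nat"
    have "(\<lambda>u. (\<lambda>(v, u). \<Phi> (u, v)) (v, u)) summable_on UNIV"
      using summable_on_SigmaD1[of "\<lambda>v u. \<Phi> (u, v)" UNIV "\<lambda>_. UNIV" v] has_sum_imp_summable[OF tot']
      by simp
    then have "((\<lambda>u. (\<lambda>(v, u). \<Phi> (u, v)) (v, u)) has_sum infsum (\<lambda>u. \<Phi> (u, v)) UNIV) UNIV"
      using has_sum_infsum[of "\<lambda>u. \<Phi> (u, v)" UNIV] by simp
    moreover have "infsum (\<lambda>u. \<Phi> (u, v)) UNIV = dcomp C P Q v * \<mu> v"
      unfolding dcomp_def \<Phi>_def by (simp add: mult.assoc[symmetric] infsum_cmult_left')
    ultimately show "((\<lambda>u. (\<lambda>(v, u). \<Phi> (u, v)) (v, u)) has_sum dcomp C P Q v * \<mu> v) UNIV"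
      by simp
  qed
  then show "((\<lambda>v. dcomp C P Q v * (z ^ fst v * w ^ snd v)) has_sum G (p z w) (q z w)) UNIV"
    by (simp add: x_def y_def \<mu>_def)
qed (rule t)

text \<open>Without a constant term, shrinking the radius by a factor \<open>c \<le> 1\<close>
  multiplies every term by at most \<open>c\<close>. The bound is stated for all small
  \<open>t\<close> so that two series can share a radius.\<close>

lemma expansion2_majorised_small:
  assumes F: "expansion2 g (curry F) r" and F0: "F 0 = 0" and e: "e > 0"
  shows "\<exists>t0>0. t0 \<le> r \<and> (\<forall>t. 0 < t \<and> t \<le> t0 \<longrightarrow> majorised F t e)"
proof -
  define t1 where "t1 = r / 2"
  have r: "r > 0" using F by (simp add: expansion2_iff)
  then have t1: "t1 > 0" "t1 < r" by (auto simp: t1_def)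
  define f where "f = (\<lambda>u. norm (F u) * t1 ^ (fst u + snd u))"
  have "((\<lambda>u. F u * (of_real t1 ^ fst u * of_real t1 ^ snd u)) has_sum g (of_real t1) (of_real t1)) UNIV"
    using F t1 unfolding expansion2_iff by auto
  then have "(\<lambda>u. F u * (of_real t1 ^ fst u * of_real t1 ^ snd u)) abs_summable_on UNIV"
    by (rule summable_on_iff_abs_summable_on_complex[THEN iffD1, OF has_sum_imp_summable])
  then have fs: "f summable_on UNIV" using t1 by (simp add: f_def norm_mult norm_power power_add)
  define M where "M = infsum f UNIV"
  have M: "M \<ge> 0" unfolding M_def using t1 by (intro infsum_nonneg) (auto simp: f_def)
  \<comment> \<open>The summand 1 in the denominator keeps the quotient defined when
    \<open>M = 0\<close>.\<close>
  define c where "c = min 1 (e / (M + 1))"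
  have c: "c > 0" "c \<le> 1" "c * M \<le> e"
  proof -
    show "c > 0" "c \<le> 1" using e M by (auto simp: c_def)
    have "c * M \<le> e / (M + 1) * M" using M by (intro mult_right_mono) (auto simp: c_def)
    also have "\<dots> \<le> e" using M e by (simp add: field_simps)
    finally show "c * M \<le> e" .
  qed
  have "majorised F t e" if t: "0 < t" "t \<le> t1 * c" for t
  proof -
    have le: "norm (F u) * t ^ (fst u + snd u) \<le> c * f u" for u
    proof (cases "u = 0")
      case True then show ?thesis using F0 by (simp add: f_def)
    next
      case False
      then obtain k where k: "fst u + snd u = Suc k"
        by (cases "fst u + snd u") (auto simp: prod_eq_iff)
      have "t ^ (fst u + snd u) \<le> (t1 * c) ^ (fst u + snd u)"
        using t by (intro power_mono) auto
      also have "\<dots> \<le> t1 ^ (fst u + snd u) * c"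
        unfolding power_mult_distrib using c t1
        by (intro mult_left_mono) (auto simp: k power_le_one mult_left_le)
      finally show ?thesis
        unfolding f_def by (metis mult.left_commute mult.commute mult_left_mono norm_ge_zero)
    qed
    have cf: "(\<lambda>u. c * f u) summable_on UNIV" using fs by (rule summable_on_cmult_right)
    have sm: "(\<lambda>u. norm (F u) * t ^ (fst u + snd u)) summable_on UNIV"
      using t by (intro summable_on_comparison_test[OF cf le]) auto
    have "(\<Sum>\<^sub>\<infinity>u. norm (F u) * t ^ (fst u + snd u)) \<le> (\<Sum>\<^sub>\<infinity>u. c * f u)"
      using sm cf le by (rule infsum_mono)
    also have "\<dots> = c * M" by (simp add: M_def infsum_cmult_right')
    finally show ?thesis using sm c by (simp add: majorised_def)
  qed
  moreover have "t1 * c > 0" "t1 * c \<le> r"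
    using t1 c order_trans[OF mult_left_le[of c t1]] by auto
  ultimately show ?thesis by blast
qed

lemma expansion2_of_expansion1:
  assumes "expansion1 p a r"
  shows "expansion2 (\<lambda>z w. p z) (curry (\<lambda>u. if snd u = 0 then a (fst u) else 0)) r"
  unfolding expansion2_iff
proof (intro conjI allI impI)
  show "r > 0" using assms by (simp add: expansion1_def)
  fix z w :: complex assume "norm z < r \<and> norm w < r"
  then have "((\<lambda>k. a k * z ^ k) has_sum p z) UNIV"
    using assms by (simp add: expansion1_def)
  moreover have "bij_betw fst (UNIV \<times> {0::nat}) (UNIV :: nat set)"
    by (rule bij_betw_byWitness[where f' = "\<lambda>i. (i, 0)"]) auto
  ultimately have "((\<lambda>u. a (fst u) * z ^ fst u) has_sum p z) (UNIV \<times> {0::nat})"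
    using has_sum_reindex_bij_betw[of fst _ _ "\<lambda>k. a k * z ^ k"] by blast
  then show "((\<lambda>u. (if snd u = 0 then a (fst u) else 0) * (z ^ fst u * w ^ snd u)) has_sum p z) UNIV"
    by (subst has_sum_cong_neutral[where T = "UNIV \<times> {0::nat}"]) auto
qed

section \<open>Uniqueness of Taylor coefficients\<close>

lemma powser_coeffs_zero:
  fixes c :: "nat \<Rightarrow> complex"
  assumes r: "r > 0" and h: "\<And>z. norm z < r \<Longrightarrow> ((\<lambda>k. c k * z ^ k) has_sum 0) UNIV"
  shows "c k = 0"
proof -
  have s: "(\<lambda>k. c k * z ^ k) sums 0" if "norm z < r" for z
    using h[OF that] by (rule has_sum_imp_sums)
  \<comment> \<open>Convergence at the single point \<open>r / 2\<close> bounds the radius of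
    convergence from below, as the identity theorem \<open>eval_fps_eqD\<close> needs a positive
    radius.\<close>
  have "fps_conv_radius (Abs_fps c) \<ge> norm (of_real (r / 2) :: complex)"
    unfolding fps_conv_radius_def using s[of "of_real (r / 2)"] r
    by (intro conv_radius_geI) (auto simp: sums_iff)
  moreover have "ereal (norm (of_real (r / 2) :: complex)) > 0"
    using r by simp
  ultimately have rad: "fps_conv_radius (Abs_fps c) > 0"
    by (rule less_le_trans[rotated])
  have "Abs_fps c = 0"
  proof (rule eval_fps_eqD)
    have "\<forall>\<^sub>F z in nhds 0. z \<in> ball (0::complex) r"
      using r by (intro eventually_nhds_in_open) auto
    then show "\<forall>\<^sub>F z in nhds 0. eval_fps (Abs_fps c) z = eval_fps 0 z"
      by eventually_elim (use s in \<open>auto simp: eval_fps_def sums_iff\<close>)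
  qed (use rad in auto)
  then show ?thesis by (metis fps_nth_Abs_fps fps_zero_nth)
qed

text \<open>The one-variable case is applied twice to the difference of the expansions: in
  \<open>w\<close> for fixed \<open>z\<close>, which makes each row sum \<open>h j\<close> vanish,
  and then in \<open>z\<close> to that row. This makes the choice in \<open>coeffs2\<close>
  determinate.\<close>

lemma expansion2_unique:
  assumes "expansion2 g a r" "expansion2 g b r'"
  shows "a = b"
proof -
  define \<rho> where "\<rho> = min r r'"
  have \<rho>: "\<rho> > 0" using assms by (auto simp: \<rho>_def expansion2_def)
  define c where "c = (\<lambda>i j. a i j - b i j)"
  have tot: "((\<lambda>(i, j). c i j * z ^ i * w ^ j) has_sum 0) UNIV" if "norm z < \<rho>" "norm w < \<rho>" for z w
  proof -
    have "((\<lambda>u. (\<lambda>(i, j). a i j * z ^ i * w ^ j) u + - (\<lambda>(i, j). b i j * z ^ i * w ^ j) u)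
            has_sum (g z w + - g z w)) UNIV"
      using assms that by (intro has_sum_add has_sum_uminusI) (auto simp: expansion2_def \<rho>_def)
    then show ?thesis by (simp add: c_def case_prod_unfold left_diff_distrib)
  qed
  have row: "((\<lambda>i. c i j * z ^ i) has_sum 0) UNIV" if z: "norm z < \<rho>" for z j
  proof -
    define h where "h = (\<lambda>j. \<Sum>\<^sub>\<infinity>i. c i j * z ^ i)"
    have summ: "(\<lambda>i. c i j * z ^ i) summable_on UNIV" for j
    proof -
      \<comment> \<open>At a nonzero \<open>w\<close>, a row of the double series is summable and
        can be divided by w^j.\<close>
      define w :: complex where "w = of_real (\<rho> / 2)"
      have w: "norm w < \<rho>" "w \<noteq> 0" using \<rho> by (auto simp: w_def)
      have "((\<lambda>(j, i). c i j * z ^ i * w ^ j) has_sum 0) (UNIV \<times> UNIV)"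
        using tot[OF z w(1)] has_sum_swap[of "\<lambda>(i, j). c i j * z ^ i * w ^ j" UNIV UNIV 0] by simp
      then have "(\<lambda>(j, i). c i j * z ^ i * w ^ j) summable_on UNIV \<times> UNIV"
        by (rule has_sum_imp_summable)
      then have "(\<lambda>i. c i j * z ^ i * w ^ j) summable_on UNIV"
        by (rule summable_on_SigmaD1) simp
      then have "(\<lambda>i. c i j * z ^ i * w ^ j * inverse (w ^ j)) summable_on UNIV"
        by (rule summable_on_cmult_left)
      then show ?thesis using w by (simp add: mult.assoc)
    qed
    have "((\<lambda>j. h j * w ^ j) has_sum 0) UNIV" if w: "norm w < \<rho>" for w
    proof -
      have t: "((\<lambda>(j, i). c i j * z ^ i * w ^ j) has_sum 0) (UNIV \<times> UNIV)"
        using tot[OF z w] has_sum_swap[of "\<lambda>(i, j). c i j * z ^ i * w ^ j" UNIV UNIV 0] by simp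
      show ?thesis
        by (rule has_sum_SigmaD[OF t])
          (use has_sum_cmult_left[OF has_sum_infsum[OF summ]] in \<open>auto simp: h_def\<close>)
    qed
    then have "h j = 0" by (rule powser_coeffs_zero[where c = h, OF \<rho>])
    then show ?thesis using has_sum_infsum[OF summ[of j]] by (simp add: h_def)
  qed
  have "c i j = 0" for i j by (rule powser_coeffs_zero[where c = "\<lambda>i. c i j", OF \<rho> row])
  then show ?thesis by (auto simp: c_def fun_eq_iff)
qed

lemma coeffs2_eqI: "expansion2 g a r \<Longrightarrow> coeffs2 g = a"
  unfolding coeffs2_def by (rule some_equality) (auto intro: expansion2_unique)

section \<open>Leading monomials\<close>

text \<open>These properties are what multiplicativity of leads rests on, so one product lemma
  covers every instance of \<open>lexw\<close>.\<close>

definition monomial_order :: "(nat \<times> nat \<Rightarrow> nat \<times> nat \<Rightarrow> bool) \<Rightarrow> bool" where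
  "monomial_order R \<longleftrightarrow> irreflp R \<and> transp R \<and> (\<forall>u v w. R u v \<longrightarrow> R (u + w) (v + w))"

text \<open>The least exponent of the support, as usual for power series, in contrast to the
  greatest one for polynomials.\<close>

definition lead :: "(nat \<times> nat \<Rightarrow> nat \<times> nat \<Rightarrow> bool) \<Rightarrow> (nat \<times> nat \<Rightarrow> 'a::zero) \<Rightarrow> nat \<times> nat \<Rightarrow> bool" where
  "lead R F v \<longleftrightarrow> F v \<noteq> 0 \<and> (\<forall>u. F u \<noteq> 0 \<longrightarrow> u = v \<or> R v u)"

text \<open>Lexicographic comparison of two weights. The iteration uses three instances: \<open>lexw 0 1 1 0\<close> compares
  the exponent of \<open>w\<close> first, while \<open>lexw B A 0 1\<close> and \<open>lexw B A 1 0\<close> compare the weight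
  whose level lines are parallel to the last edge and select the lower and the upper end of that edge.\<close>

definition lexw :: "nat \<Rightarrow> nat \<Rightarrow> nat \<Rightarrow> nat \<Rightarrow> nat \<times> nat \<Rightarrow> nat \<times> nat \<Rightarrow> bool" where
  "lexw \<alpha> \<beta> \<alpha>' \<beta>' u v \<longleftrightarrow>
     \<alpha> * fst u + \<beta> * snd u < \<alpha> * fst v + \<beta> * snd v \<or>
     \<alpha> * fst u + \<beta> * snd u = \<alpha> * fst v + \<beta> * snd v \<and> \<alpha>' * fst u + \<beta>' * snd u < \<alpha>' * fst v + \<beta>' * snd v"

lemma leadD: "lead R F v \<Longrightarrow> F u \<noteq> 0 \<Longrightarrow> u = v \<or> R v u"
  unfolding lead_def by blast

lemma monomial_order_lexw: "monomial_order (lexw \<alpha> \<beta> \<alpha>' \<beta>')"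
  unfolding monomial_order_def
proof (intro conjI)
  show "transp (lexw \<alpha> \<beta> \<alpha>' \<beta>')" by (rule transpI) (auto simp: lexw_def)
qed (auto simp: irreflp_def lexw_def distrib_left)

lemma dconv_nonzeroE:
  assumes "dconv F G v \<noteq> 0"
  obtains u u' where "u + u' = v" "F u \<noteq> 0" "G u' \<noteq> 0"
proof -
  obtain x where "x \<in> {(u, u'). u + u' = v}" "(\<lambda>(u, u'). F u * G u') x \<noteq> 0"
    using assms unfolding dconv_def by (rule sum.not_neutral_contains_not_neutral)
  then show ?thesis by (intro that[of "fst x" "snd x"]) (auto split: prod.splits)
qed

text \<open>Translation invariance leaves \<open>(v, w)\<close> as the only pair of support points
  with sum \<open>v + w\<close>. The coefficient there is a product of two nonzero elements of an
  integral domain.\<close>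

lemma lead_dconv:
  fixes F G :: "nat \<times> nat \<Rightarrow> 'a::idom"
  assumes R: "monomial_order R" and F: "lead R F v" and G: "lead R G w"
  shows "lead R (dconv F G) (v + w)"
proof -
  have irr: "\<not> R x x" and tr: "R x y \<Longrightarrow> R y z \<Longrightarrow> R x z"
    and tl: "R x y \<Longrightarrow> R (x + z) (y + z)" for x y z
    using R unfolding monomial_order_def irreflp_def transp_def by blast+
  have key: "u = v \<and> u' = w \<or> R (v + w) (u + u')" if "F u \<noteq> 0" "G u' \<noteq> 0" for u u'
  proof -
    have "u = v \<or> R v u" "u' = w \<or> R w u'" using leadD[OF F that(1)] leadD[OF G that(2)] by auto
    moreover have "R (v + w) (u + w)" if "R v u" using tl[OF that] .
    moreover have "R (u + w) (u + u')" if "R w u'" using tl[OF that, of u] by (simp add: add.commute)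
    ultimately show ?thesis using tr by blast
  qed
  have "dconv F G (v + w) = (\<Sum>(u, u')\<in>{(v, w)}. F u * G u')"
    unfolding dconv_def
  proof (rule sum.mono_neutral_right[OF finite_antidiagonal])
    show "\<forall>x\<in>{(u, u'). u + u' = v + w} - {(v, w)}. (case x of (u, u') \<Rightarrow> F u * G u') = 0"
    proof
      fix x assume x: "x \<in> {(u, u'). u + u' = v + w} - {(v, w)}"
      obtain u u' where [simp]: "x = (u, u')" by (cases x)
      have "u + u' = v + w" "\<not> (u = v \<and> u' = w)" using x by auto
      then have "F u = 0 \<or> G u' = 0" using key[of u u'] irr[of "v + w"] by auto
      then show "(case x of (u, u') \<Rightarrow> F u * G u') = 0" by auto
    qed
  qed auto
  then have "dconv F G (v + w) \<noteq> 0" using F G by (simp add: lead_def)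
  moreover have "x = v + w \<or> R (v + w) x" if x: "dconv F G x \<noteq> 0" for x
  proof -
    obtain u u' where "u + u' = x" "F u \<noteq> 0" "G u' \<noteq> 0" by (rule dconv_nonzeroE[OF x])
    then show ?thesis using key[of u u'] by auto
  qed
  ultimately show ?thesis by (simp add: lead_def)
qed

lemma lead_dpow:
  fixes F :: "nat \<times> nat \<Rightarrow> 'a::idom"
  assumes R: "monomial_order R" and F: "lead R F v"
  shows "lead R (dpow F k) (k * fst v, k * snd v)"
proof (induction k)
  case 0 then show ?case by (auto simp: lead_def zero_prod_def)
next
  case (Suc k)
  have "v + (k * fst v, k * snd v) = (Suc k * fst v, Suc k * snd v)"
    by (auto simp: prod_eq_iff)
  then show ?case using lead_dconv[OF R F Suc] by simp
qed

lemma lead_dmon: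
  fixes P Q :: "nat \<times> nat \<Rightarrow> 'a::idom"
  assumes R: "monomial_order R" and "lead R P v" "lead R Q w"
  shows "lead R (dmon P Q u) (fst u * fst v + snd u * fst w, fst u * snd v + snd u * snd w)"
  unfolding dmon_def
  using lead_dconv[OF R lead_dpow[OF R assms(2), of "fst u"] lead_dpow[OF R assms(3), of "snd u"]]
  by simp

text \<open>\<open>L u\<close> is the lead of the substituted monomial \<open>u\<close>. Strict
  minimality of \<open>L u0\<close> keeps all other monomials from contributing there, so the
  infinite sum collapses to one nonzero term and nothing cancels.\<close>

lemma lead_dcomp:
  assumes R: "monomial_order R" and P: "lead R P v" and Q: "lead R Q w"
    and L: "\<And>u. L u = (fst u * fst v + snd u * fst w, fst u * snd v + snd u * snd w)"
    and u0: "C u0 \<noteq> 0" and min: "\<And>u. C u \<noteq> 0 \<Longrightarrow> u \<noteq> u0 \<Longrightarrow> R (L u0) (L u)"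
  shows "lead R (dcomp C P Q) (L u0)"
proof -
  have irr: "\<not> R x x" and tr: "R x y \<Longrightarrow> R y z \<Longrightarrow> R x z" for x y z
    using R unfolding monomial_order_def irreflp_def transp_def by blast+
  have ld: "lead R (dmon P Q u) (L u)" for u
    unfolding L by (rule lead_dmon[OF R P Q])
  have "dcomp C P Q (L u0) = (\<Sum>\<^sub>\<infinity>u\<in>{u0}. C u * dmon P Q u (L u0))"
    unfolding dcomp_def
  proof (rule infsum_cong_neutral)
    fix u assume u: "u \<in> UNIV - {u0}"
    show "C u * dmon P Q u (L u0) = 0"
    proof (rule ccontr)
      assume "\<not> ?thesis"
      then have "C u \<noteq> 0" "dmon P Q u (L u0) \<noteq> 0" by auto
      then have "R (L u0) (L u)" "L u0 = L u \<or> R (L u) (L u0)"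
        using min[of u] u leadD[OF ld[of u]] by auto
      then show False using irr[of "L u0"] tr[of "L u0" "L u" "L u0"] by auto
    qed
  qed auto
  then have "dcomp C P Q (L u0) \<noteq> 0" using ld[of u0] u0 by (simp add: lead_def)
  moreover have "x = L u0 \<or> R (L u0) x" if x: "dcomp C P Q x \<noteq> 0" for x
  proof -
    obtain u where "C u * dmon P Q u x \<noteq> 0"
      using x infsum_0[of UNIV "\<lambda>u. C u * dmon P Q u x"] unfolding dcomp_def by blast
    then have u: "C u \<noteq> 0" "dmon P Q u x \<noteq> 0" by auto
    have "x = L u \<or> R (L u) x" using leadD[OF ld u(2)] .
    moreover have "u = u0 \<or> R (L u0) (L u)" using min u by blast
    ultimately show ?thesis using tr[of "L u0" "L u" x] by auto
  qed
  ultimately show ?thesis by (simp add: lead_def)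
qed

text \<open>Minimise the first weight, then the second among the minimisers. The nonvanishing
  determinant makes an exponent recoverable from its two weights, so the minimiser is
  unique.\<close>

lemma ex_lead_lexw:
  fixes F :: "nat \<times> nat \<Rightarrow> 'a::zero"
  assumes nd: "\<alpha> * \<beta>' \<noteq> \<alpha>' * \<beta>" and "\<exists>u. F u \<noteq> 0"
  shows "\<exists>v. lead (lexw \<alpha> \<beta> \<alpha>' \<beta>') F v"
proof -
  define f where "f = (\<lambda>u::nat \<times> nat. \<alpha> * fst u + \<beta> * snd u)"
  define g where "g = (\<lambda>u::nat \<times> nat. \<alpha>' * fst u + \<beta>' * snd u)"
  obtain x where x: "F x \<noteq> 0" "\<And>u. F u \<noteq> 0 \<Longrightarrow> f x \<le> f u"
    using ex_has_least_nat[of "\<lambda>u. F u \<noteq> 0" _ f] assms(2) by blast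
  then obtain v where v: "F v \<noteq> 0" "f v = f x" "\<And>u. F u \<noteq> 0 \<Longrightarrow> f u = f x \<Longrightarrow> g v \<le> g u"
    using ex_has_least_nat[of "\<lambda>u. F u \<noteq> 0 \<and> f u = f x" x g] by blast
  have "u = v \<or> lexw \<alpha> \<beta> \<alpha>' \<beta>' v u" if u: "F u \<noteq> 0" for u
  proof -
    have "u = v" if eq: "f u = f v" "g u = g v"
    proof -
      define a b where "a = int (fst u) - int (fst v)" and "b = int (snd u) - int (snd v)"
      have "int \<alpha> * a + int \<beta> * b = 0" "int \<alpha>' * a + int \<beta>' * b = 0"
        using eq[unfolded f_def g_def, THEN arg_cong[where f = int]]
        by (auto simp: a_def b_def algebra_simps)
      then have "(int \<alpha> * int \<beta>' - int \<alpha>' * int \<beta>) * a = 0" "(int \<alpha> * int \<beta>' - int \<alpha>' * int \<beta>) * b = 0"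
        by algebra+
      moreover have "int \<alpha> * int \<beta>' - int \<alpha>' * int \<beta> \<noteq> 0"
        using nd by (metis eq_iff_diff_eq_0 of_nat_eq_iff of_nat_mult)
      ultimately show ?thesis by (auto simp: a_def b_def prod_eq_iff)
    qed
    moreover have "f v < f u \<or> f v = f u \<and> g v < g u \<or> f u = f v \<and> g u = g v"
      using x(2)[OF u] v(2) v(3)[OF u] by linarith
    ultimately show ?thesis
      unfolding lexw_def f_def g_def by argo
  qed
  then have "lead (lexw \<alpha> \<beta> \<alpha>' \<beta>') F v" unfolding lead_def using v(1) by simp
  then show ?thesis ..
qed

section \<open>Newton polygons\<close>

text \<open>Lexicographic half-planes. The closed version will enclose a Newton polygon; the strict
  one will describe it with a vertex removed.\<close>

lemma convex_lex:
  fixes f g :: "'a::real_vector \<Rightarrow> real"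
  assumes f: "linear f" and g: "linear g"
  shows "convex {x. f x > c \<or> f x = c \<and> g x > c'}" (is ?A)
    and "convex {x. f x > c \<or> f x = c \<and> g x \<ge> c'}" (is ?B)
proof -
  have lin: "f (u *\<^sub>R x + v *\<^sub>R y) = u * f x + v * f y" "g (u *\<^sub>R x + v *\<^sub>R y) = u * g x + v * g y" for u v x y
    using f g by (auto simp: linear_add linear_scale)
  have gt: "u * p + v * q > k" if "u > 0" "v > 0" "u + v = 1" "p \<ge> k" "q \<ge> k" "p \<noteq> k \<or> q \<noteq> k"
    for u v p q k :: real
  proof -
    have "u * (p - k) + v * (q - k) > 0"
    proof (cases "p = k")
      case True
      then show ?thesis using that by simp
    next
      case False
      then show ?thesis using that by (intro add_pos_nonneg) auto
    qed
    moreover have "u * (p - k) + v * (q - k) = u * p + v * q - (u + v) * k"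
      by (simp add: algebra_simps)
    ultimately show ?thesis using that(3) by simp
  qed
  have eq: "u * k + v * k = k" if "u + v = 1" for u v k :: real
    using that by (metis distrib_right mult_1)
  have le: "u * p + v * q \<ge> k" if "u > 0" "v > 0" "u + v = 1" "p \<ge> k" "q \<ge> k" for u v p q k :: real
    using gt[OF that] eq[OF that(3), of k] by (cases "p = k \<and> q = k") auto
  \<comment> \<open>\<open>G\<close> is the condition on the boundary line; it matters only when
    both points lie on that line, since otherwise the combination is strictly inside.\<close>
  have conv: "convex {x. f x > c \<or> f x = c \<and> G x}"
    if G: "\<And>x y u v. u > 0 \<Longrightarrow> v > 0 \<Longrightarrow> u + v = 1 \<Longrightarrow> G x \<Longrightarrow> G y \<Longrightarrow> G (u *\<^sub>R x + v *\<^sub>R y)" for G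
    unfolding convex_alt
  proof (intro ballI allI impI)
    fix x y u assume h: "x \<in> {x. f x > c \<or> f x = c \<and> G x}" "y \<in> {x. f x > c \<or> f x = c \<and> G x}"
      "0 \<le> u \<and> u \<le> (1::real)"
    show "(1 - u) *\<^sub>R x + u *\<^sub>R y \<in> {x. f x > c \<or> f x = c \<and> G x}"
    proof (cases "u = 0 \<or> u = 1")
      case True
      then show ?thesis using h by auto
    next
      case False
      then have u: "1 - u > 0" "u > 0" "1 - u + u = 1" using h by auto
      show ?thesis
      proof (cases "f x = c \<and> f y = c")
        case True
        then show ?thesis using h G[OF u] eq[OF u(3), of c] by (auto simp: lin)
      next
        case False
        then show ?thesis using h gt[OF u, of c "f x" "f y"] by (auto simp: lin)
      qed
    qed
  qed
  show ?A by (rule conv) (use gt in \<open>auto simp: lin\<close>)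
  show ?B by (rule conv) (use le in \<open>auto simp: lin\<close>)
qed

lemma newton_polygonI:
  assumes "b i j \<noteq> 0" "x \<ge> real i" "y \<ge> real j"
  shows "(x, y) \<in> newton_polygon b"
  unfolding newton_polygon_def by (rule hull_inc) (use assms in auto)

text \<open>The lead is the unique lexicographic minimum on the whole polygon, so deleting it leaves
  an intersection of convex sets, and a point whose removal preserves convexity is extreme.\<close>

lemma lead_extreme_point:
  assumes nd: "\<alpha> * \<beta>' \<noteq> \<alpha>' * \<beta>" and ld: "lead (lexw \<alpha> \<beta> \<alpha>' \<beta>') (case_prod b) (i0, j0)"
  shows "(real i0, real j0) extreme_point_of newton_polygon b"
proof -
  define f where "f = (\<lambda>u::real \<times> real. real \<alpha> * fst u + real \<beta> * snd u)"
  define g where "g = (\<lambda>u::real \<times> real. real \<alpha>' * fst u + real \<beta>' * snd u)"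
  have lin: "linear f" "linear g"
    unfolding f_def g_def by (auto intro!: linearI simp: algebra_simps)
  define v where "v = (real i0, real j0)"
  \<comment> \<open>By convexity it suffices to check the generating quadrants, on which both
    nonnegative weights are least at the corner.\<close>
  have "newton_polygon b \<subseteq> {x. f x > f v \<or> f x = f v \<and> g x \<ge> g v}"
    unfolding newton_polygon_def
  proof (rule hull_minimal[where S = convex, OF _ convex_lex(2)[OF lin]], safe)
    fix i j x y assume b: "b i j \<noteq> 0" and xy: "real i \<le> x" "real j \<le> y"
      and n: "\<not> f v < f (x, y)"
    have "(i, j) = (i0, j0) \<or> lexw \<alpha> \<beta> \<alpha>' \<beta>' (i0, j0) (i, j)"
      using ld b by (auto simp: lead_def)
    then have "\<alpha> * i0 + \<beta> * j0 < \<alpha> * i + \<beta> * j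
        \<or> \<alpha> * i0 + \<beta> * j0 = \<alpha> * i + \<beta> * j \<and> \<alpha>' * i0 + \<beta>' * j0 \<le> \<alpha>' * i + \<beta>' * j"
      by (auto simp: lexw_def)
    then have "real (\<alpha> * i0 + \<beta> * j0) < real (\<alpha> * i + \<beta> * j)
        \<or> real (\<alpha> * i0 + \<beta> * j0) = real (\<alpha> * i + \<beta> * j) \<and> real (\<alpha>' * i0 + \<beta>' * j0) \<le> real (\<alpha>' * i + \<beta>' * j)"
      by (metis of_nat_less_iff of_nat_le_iff)
    then have "f v < f (i, j) \<or> f v = f (i, j) \<and> g v \<le> g (i, j)"
      by (simp add: f_def g_def v_def)
    moreover have "f (i, j) \<le> f (x, y)" "g (i, j) \<le> g (x, y)"
      unfolding f_def g_def using xy by (auto intro!: add_mono mult_left_mono)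
    ultimately show "f (x, y) = f v" "g v \<le> g (x, y)" using n by auto
  qed
  moreover have "x = v" if "f x = f v" "g x = g v" for x
  proof -
    have "(real \<alpha> * real \<beta>' - real \<alpha>' * real \<beta>) * (fst x - fst v) = 0"
      "(real \<alpha> * real \<beta>' - real \<alpha>' * real \<beta>) * (snd x - snd v) = 0"
      using that unfolding f_def g_def by algebra+
    moreover have "real \<alpha> * real \<beta>' - real \<alpha>' * real \<beta> \<noteq> 0"
      using nd by (metis eq_iff_diff_eq_0 of_nat_eq_iff of_nat_mult)
    ultimately show ?thesis by (auto simp: prod_eq_iff)
  qed
  ultimately have "newton_polygon b - {v}
      = newton_polygon b \<inter> {x. f x > f v \<or> f x = f v \<and> g x > g v}"
    by force
  moreover have "convex (newton_polygon b)" by (simp add: newton_polygon_def)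
  moreover have "v \<in> newton_polygon b"
    using ld by (auto simp: v_def lead_def intro: newton_polygonI)
  ultimately show ?thesis
    unfolding v_def[symmetric] by (simp add: extreme_point_of_stillconvex convex_Int convex_lex(1)[OF lin])
qed

text \<open>An extreme point of the hull lies in a generating quadrant. Unless it is the corner, it
  is the midpoint of the corner and the reflected corner, both in the polygon.\<close>

lemma extreme_point_coeff_nonzero:
  assumes "(real i, real j) extreme_point_of newton_polygon b"
  shows "b i j \<noteq> 0"
proof -
  obtain i' j' where b: "b i' j' \<noteq> 0" "real i' \<le> real i" "real j' \<le> real j"
    using extreme_point_of_convex_hull[OF assms[unfolded newton_polygon_def]] by auto
  have "(i', j') = (i, j)"
  proof (rule ccontr)
    assume ne: "(i', j') \<noteq> (i, j)"
    let ?u = "(real i', real j')" and ?v = "(2 * real i - real i', 2 * real j - real j')"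
    have "?u \<in> newton_polygon b" "?v \<in> newton_polygon b"
      using b by (auto intro!: newton_polygonI)
    moreover have "(real i, real j) = midpoint ?u ?v"
      by (simp add: midpoint_def)
    then have "(real i, real j) \<in> open_segment ?u ?v"
      using ne by auto
    ultimately show False using assms by (auto simp: extreme_point_of_def)
  qed
  then show ?thesis using b by simp
qed

text \<open>A vertex lies strictly below any chord of the polygon passing over it. This will put the
  earlier vertices strictly above the line of the last edge.\<close>

lemma extreme_point_below_chord:
  assumes v: "(x, y) extreme_point_of newton_polygon b"
    and P: "(x1, y1) \<in> newton_polygon b" "(x2, y2) \<in> newton_polygon b" and x: "x1 < x" "x < x2"
    and ab: "\<beta> > 0" "\<alpha> * x + \<beta> * y = \<alpha> * x2 + \<beta> * y2" and bij: "x = real i" "y = real j"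
  shows "\<alpha> * x1 + \<beta> * y1 > \<alpha> * x + \<beta> * y"
proof (rule ccontr)
  assume neg: "\<not> ?thesis"
  define t where "t = (x - x1) / (x2 - x1)"
  have t: "0 < t" "t < 1" using x by (auto simp: t_def field_simps)
  \<comment> \<open>The height of the chord at \<open>x\<close>. If the claim fails, then
    \<open>y0 \<le> y\<close>, and the vertex is interior to the chord or to a vertical segment
    starting on it.\<close>
  define y0 where "y0 = (1 - t) * y1 + t * y2"
  have "t * (x2 - x1) = x - x1" using x by (simp add: t_def)
  then have tx: "(1 - t) * x1 + t * x2 = x" by (simp add: algebra_simps)
  have w: "(x, y0) = (1 - t) *\<^sub>R (x1, y1) + t *\<^sub>R (x2, y2)" using tx by (simp add: y0_def)
  have "(x, y0) \<in> newton_polygon b"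
    unfolding w using t P by (intro convexD) (auto simp: newton_polygon_def)
  have "\<alpha> * x + \<beta> * y0 = (1 - t) * (\<alpha> * x1 + \<beta> * y1) + t * (\<alpha> * x2 + \<beta> * y2)"
    unfolding tx[symmetric] y0_def by (simp add: algebra_simps)
  also have "\<dots> \<le> (1 - t) * (\<alpha> * x + \<beta> * y) + t * (\<alpha> * x + \<beta> * y)"
    using neg t ab(2) mult_left_mono[of "\<alpha> * x1 + \<beta> * y1" "\<alpha> * x + \<beta> * y" "1 - t"] by auto
  also have "\<dots> = \<alpha> * x + \<beta> * y" by (simp add: algebra_simps)
  finally have "\<beta> * y0 \<le> \<beta> * y" by simp
  then have y0: "y0 \<le> y" using ab(1) by simp
  show False
  proof (cases "y0 = y")
    case True
    then have "(x, y) \<in> open_segment (x1, y1) (x2, y2)"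
      using t x w by (auto simp: in_segment)
    then show False using v P by (auto simp: extreme_point_of_def)
  next
    case False
    have "(x, 2 * y - y0) \<in> newton_polygon b"
      using y0 extreme_point_coeff_nonzero[of i j b] v bij by (intro newton_polygonI[of b i j]) auto
    moreover have "(x, y) = midpoint (x, y0) (x, 2 * y - y0)" by (simp add: midpoint_def)
    then have "(x, y) \<in> open_segment (x, y0) (x, 2 * y - y0)" using False by auto
    ultimately show False using v \<open>(x, y0) \<in> newton_polygon b\<close> by (auto simp: extreme_point_of_def)
  qed
qed

text \<open>Each lead exists and is a vertex, so only the listed vertices have to be compared. The
  width \<open>A\<close> and height \<open>B\<close> enter through sums, which avoids truncated
  subtraction.\<close>

lemma last_edge_leads:
  fixes n m :: "nat \<Rightarrow> nat"
  assumes nz: "\<exists>i j. b i j \<noteq> 0"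
    and n_mono: "\<forall>k. 1 \<le> k \<and> k < s \<longrightarrow> n k < n (Suc k)"
    and m_mono: "\<forall>k. 1 \<le> k \<and> k < s \<longrightarrow> m k > m (Suc k)"
    and vertices: "{v. v extreme_point_of newton_polygon b} = {(real (n k), real (m k)) | k. 1 \<le> k \<and> k \<le> s}"
    and s: "s > 1"
    and A: "A + n (s - 1) = n s" and B: "B + m s = m (s - 1)"
  shows "lead (lexw 0 1 1 0) (case_prod b) (n s, m s)"
    and "lead (lexw B A 0 1) (case_prod b) (n s, m s)"
    and "lead (lexw B A 1 0) (case_prod b) (n (s - 1), m (s - 1))"
proof -
  have less: "n k < n l \<and> m l < m k" if "k < l" "1 \<le> k" "l \<le> s" for k l
    using that
  proof (induction rule: strict_inc_induct)
    case (base k) then show ?case using n_mono m_mono by auto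
  next
    case (step k) then show ?case using n_mono m_mono by (smt (verit) Suc_leD Suc_le_eq le_trans less_trans not_less_eq_eq)
  qed
  have n': "n (s - 1) < n s" "m s < m (s - 1)" using less[of "s - 1" s] s by auto
  then have AB: "A > 0" "B > 0" using A B by auto
  have ext: "(real (n k), real (m k)) extreme_point_of newton_polygon b" if "1 \<le> k" "k \<le> s" for k
    using vertices that by blast
  then have supp: "b (n k) (m k) \<noteq> 0" if "1 \<le> k" "k \<le> s" for k
    using that extreme_point_coeff_nonzero by blast
  have vertex: "\<exists>k. 1 \<le> k \<and> k \<le> s \<and> v = (n k, m k)"
    if "lead (lexw \<alpha> \<beta> \<alpha>' \<beta>') (case_prod b) v" "\<alpha> * \<beta>' \<noteq> \<alpha>' * \<beta>" for \<alpha> \<beta> \<alpha>' \<beta>' v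
  proof -
    have "(real (fst v), real (snd v)) extreme_point_of newton_polygon b"
      by (rule lead_extreme_point[OF that(2)]) (use that(1) in simp)
    then have "(real (fst v), real (snd v)) \<in> {(real (n k), real (m k)) | k. 1 \<le> k \<and> k \<le> s}"
      using vertices by blast
    then show ?thesis by (auto simp: prod_eq_iff)
  qed
  have edge: "B * n s + A * m s = B * n (s - 1) + A * m (s - 1)"
  proof -
    have "B * n s + A * m s = B * (A + n (s - 1)) + A * m s" by (simp only: A)
    also have "\<dots> = B * n (s - 1) + A * (B + m s)" by (simp add: algebra_simps)
    finally show ?thesis by (simp only: B)
  qed
  \<comment> \<open>The vertex \<open>s - 1\<close> lies below the chord from vertex
    \<open>k\<close> to vertex \<open>s\<close>, and the weight is constant along the last
    edge.\<close>
  have above: "B * n s + A * m s < B * n k + A * m k" if "1 \<le> k" "k < s - 1" for k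
  proof -
    have "real B * real (n (s - 1)) + real A * real (m (s - 1)) < real B * real (n k) + real A * real (m k)"
    proof (rule extreme_point_below_chord[OF ext _ _ _ _ _ _ refl refl])
      show "(real (n k), real (m k)) \<in> newton_polygon b" "(real (n s), real (m s)) \<in> newton_polygon b"
        using ext[of k] ext[of s] that s by (auto simp: extreme_point_of_def)
      show "real B * real (n (s - 1)) + real A * real (m (s - 1)) = real B * real (n s) + real A * real (m s)"
        using edge[THEN arg_cong[where f = real]] by simp
    qed (use that s n' AB less[of k "s - 1"] in auto)
    then have "real (B * n (s - 1) + A * m (s - 1)) < real (B * n k + A * m k)" by simp
    then show ?thesis using edge by linarith
  qed
  have nz': "\<exists>u. case_prod b u \<noteq> 0" using nz by auto
  show "lead (lexw 0 1 1 0) (case_prod b) (n s, m s)"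
  proof -
    obtain v where v: "lead (lexw 0 1 1 0) (case_prod b) v"
      using ex_lead_lexw[OF _ nz', of 0 0 1 1] by auto
    then obtain k where k: "1 \<le> k" "k \<le> s" "v = (n k, m k)" using vertex[OF v] by auto
    have "(n s, m s) = v \<or> lexw 0 1 1 0 v (n s, m s)"
      using v supp[of s] s unfolding lead_def by (metis case_prod_conv less_imp_le order_refl)
    then have "m k \<le> m s" using k by (auto simp: lexw_def)
    then have "k = s" using less[of k s] k by force
    then show ?thesis using v k by simp
  qed
  show "lead (lexw B A 0 1) (case_prod b) (n s, m s)"
  proof -
    obtain v where v: "lead (lexw B A 0 1) (case_prod b) v"
      using ex_lead_lexw[OF _ nz', of B 1 0 A] AB by auto
    then obtain k where k: "1 \<le> k" "k \<le> s" "v = (n k, m k)" using vertex[OF v] AB by auto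
    have "(n s, m s) = v \<or> lexw B A 0 1 v (n s, m s)"
      using v supp[of s] s unfolding lead_def by (metis case_prod_conv less_imp_le order_refl)
    then have *: "B * n k + A * m k < B * n s + A * m s \<or> B * n k + A * m k = B * n s + A * m s \<and> m k \<le> m s"
      using k by (auto simp: lexw_def)
    have "k = s"
    proof (rule ccontr)
      assume "k \<noteq> s"
      \<comment> \<open>Vertices before the last edge are too heavy; the other end of the edge has
        equal weight and loses the tie-break.\<close>
      then have "k < s - 1 \<or> k = s - 1" using k by auto
      then show False using above[of k] * edge n' k by auto
    qed
    then show ?thesis using v k by simp
  qed
  show "lead (lexw B A 1 0) (case_prod b) (n (s - 1), m (s - 1))"
  proof -
    obtain v where v: "lead (lexw B A 1 0) (case_prod b) v"
      using ex_lead_lexw[OF _ nz', of B 0 1 A] AB by auto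
    then obtain k where k: "1 \<le> k" "k \<le> s" "v = (n k, m k)" using vertex[OF v] AB by auto
    have "(n (s - 1), m (s - 1)) = v \<or> lexw B A 1 0 v (n (s - 1), m (s - 1))"
      using v supp[of "s - 1"] s unfolding lead_def by auto
    then have *: "B * n k + A * m k < B * n s + A * m s \<or> B * n k + A * m k = B * n s + A * m s \<and> n k \<le> n (s - 1)"
      using k edge by (auto simp: lexw_def)
    have "k = s - 1"
    proof (rule ccontr)
      assume "k \<noteq> s - 1"
      then have "k < s - 1 \<or> k = s" using k by auto
      then show False using above[of k] * edge n' k by auto
    qed
    then show ?thesis using v k by simp
  qed
qed

section \<open>Iterates of the skew product\<close>

text \<open>A series in z alone is supported on the z-axis, where one positive z-weight makes larger
  exponents larger in the order.\<close>

lemma lead_one_variable: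
  fixes a :: "nat \<Rightarrow> 'a::zero"
  assumes "\<forall>k<\<delta>. a k = 0" "a \<delta> \<noteq> 0" "\<alpha> > 0 \<or> \<alpha>' > 0"
  shows "lead (lexw \<alpha> \<beta> \<alpha>' \<beta>') (\<lambda>u. if snd u = 0 then a (fst u) else 0) (\<delta>, 0)"
  unfolding lead_def
proof (intro conjI allI impI)
  fix u :: "nat \<times> nat" assume "(if snd u = 0 then a (fst u) else 0) \<noteq> 0"
  then have "snd u = 0" "fst u \<ge> \<delta>" using assms(1) by (auto split: if_splits simp: not_less[symmetric])
  then show "u = (\<delta>, 0) \<or> lexw \<alpha> \<beta> \<alpha>' \<beta>' (\<delta>, 0) u"
    using assms(3) by (cases u) (auto simp: lexw_def)
qed (use assms in simp)

text \<open>The lead of the substituted monomial \<open>u\<close> is \<open>L u\<close> for the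
  first two orders and \<open>L' u\<close> for the third; both weigh \<open>\<delta>\<close> times
  the weight of \<open>u\<close> plus \<open>D\<close> times its w-exponent. If
  \<open>D = 0\<close>, level lines go to level lines. If \<open>D > 0\<close>,
  \<open>(g, e)\<close> is the only monomial of \<open>C\<close> whose image has least
  weight.\<close>

lemma leads_dcomp:
  assumes pos: "\<delta> > 0" "d > 0" "A > 0" "B > 0" "m' > 0"
    and D: "B * \<gamma> + A * d = A * \<delta> + D" "B * n' + A * m' = A * \<delta> + D"
    and P: "lead (lexw 0 1 1 0) P (\<delta>, 0)" "lead (lexw B A 0 1) P (\<delta>, 0)" "lead (lexw B A 1 0) P (\<delta>, 0)"
    and Q: "lead (lexw 0 1 1 0) Q (\<gamma>, d)" "lead (lexw B A 0 1) Q (\<gamma>, d)" "lead (lexw B A 1 0) Q (n', m')"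
    and C: "lead (lexw 0 1 1 0) C (g, e)" "lead (lexw B A 0 1) C (g, e)" "lead (lexw B A 1 0) C (I, J)"
  shows "lead (lexw 0 1 1 0) (dcomp C P Q) (g * \<delta> + e * \<gamma>, e * d)" (is ?T1)
    and "lead (lexw B A 0 1) (dcomp C P Q) (g * \<delta> + e * \<gamma>, e * d)" (is ?T2)
    and "D = 0 \<Longrightarrow> lead (lexw B A 1 0) (dcomp C P Q) (I * \<delta> + J * n', J * m')" (is "_ \<Longrightarrow> ?T3")
    and "D > 0 \<Longrightarrow> lead (lexw B A 1 0) (dcomp C P Q) (g * \<delta> + e * n', e * m')" (is "_ \<Longrightarrow> ?T4")
proof -
  define L where "L = (\<lambda>u. (fst u * \<delta> + snd u * \<gamma>, snd u * d))"
  define L' where "L' = (\<lambda>u. (fst u * \<delta> + snd u * n', snd u * m'))"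
  have wt: "B * (i * \<delta> + j * \<gamma>) + A * (j * d) = \<delta> * (B * i + A * j) + D * j"
    "B * (i * \<delta> + j * n') + A * (j * m') = \<delta> * (B * i + A * j) + D * j" for i j
  proof -
    have "B * (i * \<delta> + j * \<gamma>) + A * (j * d) = \<delta> * (B * i) + j * (B * \<gamma> + A * d)"
      "B * (i * \<delta> + j * n') + A * (j * m') = \<delta> * (B * i) + j * (B * n' + A * m')"
      by (auto simp: algebra_simps)
    then show "B * (i * \<delta> + j * \<gamma>) + A * (j * d) = \<delta> * (B * i + A * j) + D * j"
      "B * (i * \<delta> + j * n') + A * (j * m') = \<delta> * (B * i + A * j) + D * j"
      unfolding D by (auto simp: algebra_simps)
  qed
  have nz: "C (g, e) \<noteq> 0" "C (I, J) \<noteq> 0" using C by (auto simp: lead_def)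
  have C1: "e < j \<or> e = j \<and> g < i" if "C (i, j) \<noteq> 0" "(i, j) \<noteq> (g, e)" for i j
    using C(1) that by (auto simp: lead_def lexw_def)
  then have ej: "e \<le> j" if "C (i, j) \<noteq> 0" for i j using that by (cases "(i, j) = (g, e)") fastforce+
  have C2: "B * g + A * e < B * i + A * j \<or> B * g + A * e = B * i + A * j \<and> e < j"
    if "C (i, j) \<noteq> 0" "(i, j) \<noteq> (g, e)" for i j
    using C(2) that by (auto simp: lead_def lexw_def)
  have C3: "B * I + A * J < B * i + A * j \<or> B * I + A * J = B * i + A * j \<and> I < i"
    if "C (i, j) \<noteq> 0" "(i, j) \<noteq> (I, J)" for i j
    using C(3) that by (auto simp: lead_def lexw_def)
  have "lead (lexw 0 1 1 0) (dcomp C P Q) (L (g, e))"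
  proof (rule lead_dcomp[where L = L and ?u0.0 = "(g, e)", OF monomial_order_lexw P(1) Q(1)])
    fix u assume "C u \<noteq> 0" "u \<noteq> (g, e)"
    then show "lexw 0 1 1 0 (L (g, e)) (L u)"
      using C1[of "fst u" "snd u"] pos by (auto simp: lexw_def L_def)
  qed (use nz in \<open>auto simp: L_def\<close>)
  then show ?T1 by (simp add: L_def)
  have "lead (lexw B A 0 1) (dcomp C P Q) (L (g, e))"
  proof (rule lead_dcomp[where L = L and ?u0.0 = "(g, e)", OF monomial_order_lexw P(2) Q(2)])
    fix u assume u: "C u \<noteq> 0" "u \<noteq> (g, e)"
    obtain i j where [simp]: "u = (i, j)" by fastforce
    \<comment> \<open>\<open>(g, e)\<close> minimises both summands of the image weight, and a tie
      is settled by the w-exponent.\<close>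
    have "D * e \<le> D * j" using ej[of i j] u by simp
    moreover have "\<delta> * (B * g + A * e) < \<delta> * (B * i + A * j) \<or>
        \<delta> * (B * g + A * e) = \<delta> * (B * i + A * j) \<and> e * d < j * d"
      using C2[of i j] u pos by auto
    ultimately show "lexw B A 0 1 (L (g, e)) (L u)"
      unfolding lexw_def L_def by (simp only: wt fst_conv snd_conv \<open>u = _\<close>) linarith
  qed (use nz in \<open>auto simp: L_def\<close>)
  then show ?T2 by (simp add: L_def)
  show ?T3 if D0: "D = 0"
  proof -
    have "lead (lexw B A 1 0) (dcomp C P Q) (L' (I, J))"
    proof (rule lead_dcomp[where L = L' and ?u0.0 = "(I, J)", OF monomial_order_lexw P(3) Q(3)])
      fix u assume u: "C u \<noteq> 0" "u \<noteq> (I, J)"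
      obtain i j where [simp]: "u = (i, j)" by fastforce
      have wt': "B * (i * \<delta> + j * n') + A * (j * m') = \<delta> * (B * i + A * j)" for i j
        using wt(2)[of i j] D0 by simp
      consider "B * I + A * J < B * i + A * j" | "B * I + A * J = B * i + A * j" "I < i"
        using C3[of i j] u by auto
      then have "B * (I * \<delta> + J * n') + A * (J * m') < B * (i * \<delta> + j * n') + A * (j * m') \<or>
          B * (I * \<delta> + J * n') + A * (J * m') = B * (i * \<delta> + j * n') + A * (j * m') \<and>
          I * \<delta> + J * n' < i * \<delta> + j * n'"
      proof cases
        case 1 then show ?thesis using wt' pos by simp
      next
        case 2
        \<comment> \<open>The z-exponents of the images cannot be compared directly, as
          \<open>I < i\<close> but \<open>J > j\<close>. The w-exponents can, and on a common level
          line a smaller w-exponent means a larger z-exponent.\<close>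
        have "B * I < B * i" using 2 pos by simp
        then have "A * j < A * J" using 2 by linarith
        then have "A * (j * m') < A * (J * m')" using pos by simp
        moreover have eq: "B * (I * \<delta> + J * n') + A * (J * m') = B * (i * \<delta> + j * n') + A * (j * m')"
          using 2 wt' by simp
        ultimately have "B * (I * \<delta> + J * n') < B * (i * \<delta> + j * n')" by linarith
        then have "I * \<delta> + J * n' < i * \<delta> + j * n'" by (simp only: nat_mult_less_cancel1[OF pos(4)])
        then show ?thesis using eq by blast
      qed
      then show "lexw B A 1 0 (L' (I, J)) (L' u)" unfolding lexw_def L'_def by simp
    qed (use nz in \<open>auto simp: L'_def\<close>)
    then show ?thesis by (simp add: L'_def)
  qed
  show ?T4 if D1: "D > 0"
  proof -
    have "lead (lexw B A 1 0) (dcomp C P Q) (L' (g, e))"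
    proof (rule lead_dcomp[where L = L' and ?u0.0 = "(g, e)", OF monomial_order_lexw P(3) Q(3)])
      fix u assume u: "C u \<noteq> 0" "u \<noteq> (g, e)"
      obtain i j where [simp]: "u = (i, j)" by fastforce
      \<comment> \<open>With \<open>D > 0\<close>, even a tie between the old weights leads to a
        strictly larger new weight.\<close>
      have "D * e \<le> D * j" using ej[of i j] u by simp
      moreover have "\<delta> * (B * g + A * e) < \<delta> * (B * i + A * j) \<or>
          \<delta> * (B * g + A * e) = \<delta> * (B * i + A * j) \<and> D * e < D * j"
        using C2[of i j] u pos D1 by auto
      ultimately show "lexw B A 1 0 (L' (g, e)) (L' u)"
        unfolding lexw_def L'_def by (simp only: wt fst_conv snd_conv \<open>u = _\<close>) linarith
    qed (use nz in \<open>auto simp: L'_def\<close>)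
    then show ?thesis by (simp add: L'_def)
  qed
qed

section \<open>Recursion for the iterates\<close>

lemma gamma_n_Suc_0: "gamma_n \<gamma> \<delta> d (Suc 0) = \<gamma>"
  by (simp add: gamma_n_def)

text \<open>This recursion is the first coordinate of the new lead when the old one is
  \<open>(gamma_n \<gamma> \<delta> d k, d ^ k)\<close>.\<close>

lemma gamma_n_Suc: "gamma_n \<gamma> \<delta> d (Suc k) = gamma_n \<gamma> \<delta> d k * \<delta> + d ^ k * \<gamma>"
proof -
  have "(\<Sum>j<k. \<delta> ^ (k - j) * d ^ j) = \<delta> * (\<Sum>j<k. \<delta> ^ (k - 1 - j) * d ^ j)"
    unfolding sum_distrib_left
  proof (rule sum.cong)
    fix j assume "j \<in> {..<k}"
    then have "k - j = Suc (k - 1 - j)" by auto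
    then show "\<delta> ^ (k - j) * d ^ j = \<delta> * (\<delta> ^ (k - 1 - j) * d ^ j)" by simp
  qed simp
  then show ?thesis by (simp add: gamma_n_def algebra_simps)
qed

lemma Qn_Suc_0: "Qn p q (Suc 0) = q"
  by (simp add: Qn_def skew_def)

text \<open>The innermost map is split off, so that every step substitutes the same pair
  \<open>(p, q)\<close> into the previous iterate.\<close>

lemma Qn_Suc: "Qn p q (Suc k) = (\<lambda>z w. Qn p q k (p z) (q z w))"
  by (simp add: Qn_def funpow_Suc_right skew_def del: funpow.simps)

text \<open>Germs without constant term are small on a small polydisc; the bound
  \<open>r / 2\<close> lies strictly inside the outer radius.\<close>

lemma expansion2_compose:
  assumes G: "expansion2 G (curry C) r" and P: "expansion2 p (curry P) r1" "P 0 = 0"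
    and Q: "expansion2 q (curry Q) r2" "Q 0 = 0"
  shows "\<exists>t. expansion2 (\<lambda>z w. G (p z w) (q z w)) (curry (dcomp C P Q)) t"
proof -
  have r: "r / 2 > 0" "r / 2 < r" using G by (auto simp: expansion2_iff)
  obtain t1 where t1: "t1 > 0" "t1 \<le> r1" "\<And>t. 0 < t \<Longrightarrow> t \<le> t1 \<Longrightarrow> majorised P t (r / 2)"
    using expansion2_majorised_small[OF P r(1)] by blast
  obtain t2 where t2: "t2 > 0" "t2 \<le> r2" "\<And>t. 0 < t \<Longrightarrow> t \<le> t2 \<Longrightarrow> majorised Q t (r / 2)"
    using expansion2_majorised_small[OF Q r(1)] by blast
  have "expansion2 (\<lambda>z w. G (p z w) (q z w)) (curry (dcomp C P Q)) (min t1 t2)"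
    by (rule expansion2_dcomp[OF G _ r(2) _ P(1) _ _ Q(1)]) (use t1 t2 in auto)
  then show ?thesis by blast
qed

section \<open>The order of a germ from its leads\<close>

lemma ord2_properties:
  assumes "expansion2 g (curry C) r" and "C v \<noteq> 0"
  shows "\<exists>u. C u \<noteq> 0 \<and> ord2 g = fst u + snd u" and "C u \<noteq> 0 \<Longrightarrow> ord2 g \<le> fst u + snd u"
proof -
  have ord: "ord2 g = (LEAST k. \<exists>i j. i + j = k \<and> C (i, j) \<noteq> 0)"
    unfolding ord2_def coeffs2_eqI[OF assms(1)] by simp
  have "\<exists>i j. i + j = ord2 g \<and> C (i, j) \<noteq> 0"
    unfolding ord by (rule LeastI[of _ "fst v + snd v"]) (use assms(2) in \<open>metis prod.collapse\<close>)
  then show "\<exists>u. C u \<noteq> 0 \<and> ord2 g = fst u + snd u" by force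
  show "C u \<noteq> 0 \<Longrightarrow> ord2 g \<le> fst u + snd u"
    unfolding ord by (rule Least_le) (metis prod.collapse)
qed

text \<open>Let \<open>(i, j)\<close> be a monomial of least degree. For \<open>A \<le> B\<close>,
  \<open>B\<close> times the degree is the weight plus \<open>(B - A) * j\<close>, and
  \<open>(g, e)\<close> minimises both. For \<open>B < A\<close>, \<open>A\<close> times the degree
  is at least the weight, with equality only on the w-axis; \<open>I\<close> is the least z-exponent
  on the edge of least weight.\<close>

lemma ord2_from_leads:
  assumes ex: "expansion2 h (curry C) r"
    and C: "lead (lexw 0 1 1 0) C (g, e)" "lead (lexw B A 0 1) C (g, e)" "lead (lexw B A 1 0) C (I, J)"
    and IJ: "B * I + A * J = B * g + A * e" "e < J" and pos: "A > 0" "B > 0"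
  shows "A \<le> B \<Longrightarrow> ord2 h = g + e"
    and "B < A \<Longrightarrow> B * g + A * e \<le> A * ord2 h \<and> ord2 h < g + e"
    and "B < A \<Longrightarrow> I > 0 \<Longrightarrow> B * g + A * e < A * ord2 h"
    and "B < A \<Longrightarrow> I = 0 \<Longrightarrow> B * g + A * e = A * ord2 h"
proof -
  have nz: "C (g, e) \<noteq> 0" "C (I, J) \<noteq> 0" using C by (auto simp: lead_def)
  obtain i j where ij: "C (i, j) \<noteq> 0" "ord2 h = i + j"
    using ord2_properties(1)[OF ex nz(1)] by auto
  have le: "ord2 h \<le> g + e" "ord2 h \<le> I + J"
    using ord2_properties(2)[OF ex nz(1)] nz by fastforce+
  have "(i, j) = (g, e) \<or> lexw 0 1 1 0 (g, e) (i, j)" "(i, j) = (g, e) \<or> lexw B A 0 1 (g, e) (i, j)"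
    "(i, j) = (I, J) \<or> lexw B A 1 0 (I, J) (i, j)"
    using C ij(1) unfolding lead_def by blast+
  then have j: "e \<le> j" and w: "B * g + A * e \<le> B * i + A * j"
    and I: "B * i + A * j = B * I + A * J \<Longrightarrow> I \<le> i"
    by (auto simp: lexw_def)
  show "ord2 h = g + e" if AB: "A \<le> B"
  proof -
    obtain E where E: "B = A + E" using AB le_Suc_ex by blast
    have "B * (g + e) = B * g + A * e + E * e" by (simp add: E algebra_simps)
    also have "\<dots> \<le> B * i + A * j + E * j" using w mult_le_mono2[OF j, of E] by linarith
    also have "\<dots> = B * (i + j)" by (simp add: E algebra_simps)
    finally have "g + e \<le> i + j" using pos(2) by (simp only: mult_le_cancel1)
    then show ?thesis using le ij by simp
  qed
  have low: "B * i + A * j \<le> A * ord2 h" and low': "i > 0 \<Longrightarrow> B * i + A * j < A * ord2 h" if AB: "B < A"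
    using AB by (auto simp: ij distrib_left)
  show "B * g + A * e \<le> A * ord2 h \<and> ord2 h < g + e" if AB: "B < A"
  proof
    show "B * g + A * e \<le> A * ord2 h" using low[OF AB] w by simp
    obtain E where E: "A = B + E" "E > 0" using AB less_imp_add_positive by blast
    \<comment> \<open>On a level line \<open>B\<close> times the degree is the weight minus
      \<open>E\<close> times the w-exponent, so the upper end has the smaller degree.\<close>
    have "B * (I + J) + E * J = B * (g + e) + E * e" using IJ by (simp add: E algebra_simps)
    moreover have "E * e < E * J" using IJ E by simp
    ultimately have "B * (I + J) < B * (g + e)" by linarith
    then have "I + J < g + e" by (simp only: mult_less_cancel1)
    then show "ord2 h < g + e" using le by simp
  qed
  show "B * g + A * e < A * ord2 h" if AB: "B < A" and I0: "I > 0"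
  proof (cases "B * i + A * j = B * I + A * J")
    case True
    then show ?thesis using low'[OF AB] I I0 w by simp
  next
    case False
    then show ?thesis using low[OF AB] w IJ by simp
  qed
  show "B * g + A * e = A * ord2 h" if AB: "B < A" and I0: "I = 0"
  proof -
    have "A * ord2 h \<le> A * J" using le(2) I0 by simp
    moreover have "A * J = B * g + A * e" using IJ I0 by simp
    ultimately show ?thesis using low[OF AB] w by linarith
  qed
qed

text \<open>The last conjuncts record whether the upper end lies on the w-axis. At
  \<open>k = 1\<close> it is \<open>(n', m')\<close> whatever \<open>D\<close> is. Later,
  \<open>D > 0\<close> makes \<open>I\<close> the sum of a positive multiple of the previous
  \<open>gamma_n\<close> and a multiple of \<open>n'\<close>, which is why positivity of
  \<open>gamma_n\<close> is carried along.\<close>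

lemma Qn_leads:
  assumes p: "expansion1 p a rp" "\<forall>k<\<delta>. a k = 0" "a \<delta> \<noteq> 0"
    and q: "expansion2 q b rq" "b 0 0 = 0"
    and pos: "\<delta> > 0" "d > 0" "A > 0" "B > 0" "d < m'" "\<gamma> > 0"
    and D: "B * \<gamma> + A * d = A * \<delta> + D" "B * n' + A * m' = A * \<delta> + D"
    and Q: "lead (lexw 0 1 1 0) (case_prod b) (\<gamma>, d)" "lead (lexw B A 0 1) (case_prod b) (\<gamma>, d)"
      "lead (lexw B A 1 0) (case_prod b) (n', m')"
    and k: "k \<ge> 1"
  shows "\<exists>C r I J. expansion2 (Qn p q k) (curry C) r \<and>
    lead (lexw 0 1 1 0) C (gamma_n \<gamma> \<delta> d k, d ^ k) \<and> lead (lexw B A 0 1) C (gamma_n \<gamma> \<delta> d k, d ^ k) \<and>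
    lead (lexw B A 1 0) C (I, J) \<and> B * I + A * J = B * gamma_n \<gamma> \<delta> d k + A * d ^ k \<and> d ^ k < J \<and>
    gamma_n \<gamma> \<delta> d k > 0 \<and> (n' > 0 \<longrightarrow> I > 0) \<and> (D > 0 \<and> k \<ge> 2 \<longrightarrow> I > 0) \<and>
    (n' = 0 \<and> (D = 0 \<or> k = 1) \<longrightarrow> I = 0)"
  using k
proof (induction k rule: dec_induct)
  case base
  show ?case
    by (rule exI[of _ "case_prod b"], rule exI[of _ rq], rule exI[of _ n'], rule exI[of _ m'])
      (use q Q D pos in \<open>simp add: gamma_n_Suc_0 Qn_Suc_0\<close>)
next
  case (step k)
  define g where "g = gamma_n \<gamma> \<delta> d k"
  define e where "e = d ^ k"
  define P where "P = (\<lambda>u::nat \<times> nat. if snd u = 0 then a (fst u) else 0)"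
  obtain C r I J where C: "expansion2 (Qn p q k) (curry C) r"
      "lead (lexw 0 1 1 0) C (g, e)" "lead (lexw B A 0 1) C (g, e)" "lead (lexw B A 1 0) C (I, J)"
    and IJ: "B * I + A * J = B * g + A * e" "e < J" "g > 0" "n' > 0 \<longrightarrow> I > 0"
      "n' = 0 \<and> (D = 0 \<or> k = 1) \<longrightarrow> I = 0"
    using step.IH unfolding g_def e_def by blast
  have P0: "P 0 = 0" using p(2) pos(1) by (simp add: P_def)
  have P: "lead (lexw 0 1 1 0) P (\<delta>, 0)" "lead (lexw B A 0 1) P (\<delta>, 0)" "lead (lexw B A 1 0) P (\<delta>, 0)"
    unfolding P_def using pos by (auto intro!: lead_one_variable p)
  obtain t where t: "expansion2 (Qn p q (Suc k)) (curry (dcomp C P (case_prod b))) t"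
    using expansion2_compose[OF C(1) expansion2_of_expansion1[OF p(1), folded P_def] P0, of q "case_prod b" rq] q
    by (auto simp: Qn_Suc zero_prod_def)
  have m': "m' > 0" using pos by simp
  note ld = leads_dcomp[OF pos(1-4) m' D P Q C(2-4)]
  have Suc_eqs: "gamma_n \<gamma> \<delta> d (Suc k) = g * \<delta> + e * \<gamma>" "d ^ Suc k = e * d"
    by (simp_all add: gamma_n_Suc g_def e_def)
  have e: "e > 0" using pos by (simp add: e_def)
  have wt: "B * (g * \<delta> + e * \<gamma>) + A * (e * d) = \<delta> * (B * g + A * e) + D * e"
  proof -
    have "B * (g * \<delta> + e * \<gamma>) + A * (e * d) = \<delta> * (B * g) + e * (B * \<gamma> + A * d)" by (simp add: algebra_simps)
    then show ?thesis unfolding D by (simp add: algebra_simps)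
  qed
  have wt': "B * (i * \<delta> + j * n') + A * (j * m') = \<delta> * (B * i + A * j) + D * j" for i j
  proof -
    have "B * (i * \<delta> + j * n') + A * (j * m') = \<delta> * (B * i) + j * (B * n' + A * m')" by (simp add: algebra_simps)
    then show ?thesis unfolding D by (simp add: algebra_simps)
  qed
  \<comment> \<open>The cases \<open>D = 0\<close> and \<open>D > 0\<close> differ only in the upper
    end \<open>(I', J')\<close>; everything about the lower end is shared.\<close>
  have concl: ?case
    if "lead (lexw B A 1 0) (dcomp C P (case_prod b)) (I', J')"
      "B * I' + A * J' = \<delta> * (B * g + A * e) + D * e" "e * d < J'"
      "n' > 0 \<Longrightarrow> I' > 0" "D > 0 \<Longrightarrow> I' > 0" "n' = 0 \<Longrightarrow> D = 0 \<Longrightarrow> I' = 0" for I' J'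
    unfolding Suc_eqs
    by (rule exI[of _ "dcomp C P (case_prod b)"], rule exI[of _ t], rule exI[of _ I'], rule exI[of _ J'],
        intro conjI) (rule t ld(1,2) that(1,3) | use that(2,4-6) wt pos IJ(3) step.hyps in auto)+
  show ?case
  proof (cases "D = 0")
    case True
    show ?thesis
    proof (rule concl[of "I * \<delta> + J * n'" "J * m'"])
      show "e * d < J * m'" using IJ pos by (intro mult_strict_mono) auto
    qed (use ld(3) wt'[of I J] IJ True pos in auto)
  next
    case False
    show ?thesis
    proof (rule concl[of "g * \<delta> + e * n'" "e * m'"])
      show "e * d < e * m'" using pos e by simp
    qed (use ld(4) wt'[of g e] IJ False pos in auto)
  qed
qed

section \<open>Assembling the estimates of the order\<close>

theorem theorem3p3:
  fixes p :: "complex \<Rightarrow> complex" and q :: "complex \<Rightarrow> complex \<Rightarrow> complex"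
    and a :: "nat \<Rightarrow> complex" and b :: "nat \<Rightarrow> nat \<Rightarrow> complex"
    and \<delta> s :: nat and n m :: "nat \<Rightarrow> nat" and rp rq :: real
  assumes p_exp: "expansion1 p a rp"
    and \<delta>_pos: "\<delta> \<ge> 1" and a_low: "\<forall>k<\<delta>. a k = 0" and a_\<delta>: "a \<delta> \<noteq> 0"
    and q_exp: "expansion2 q b rq"
    and b00: "b 0 0 = 0" and q_nonzero: "\<exists>i j. b i j \<noteq> 0"
    and n_mono: "\<forall>k. 1 \<le> k \<and> k < s \<longrightarrow> n k < n (Suc k)"
    and m_mono: "\<forall>k. 1 \<le> k \<and> k < s \<longrightarrow> m k > m (Suc k)"
    and vertices: "{v. v extreme_point_of newton_polygon b}
                   = {(real (n k), real (m k)) | k. 1 \<le> k \<and> k \<le> s}"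
    and case2: "s > 1"
      "real \<delta> \<le> y_intercept (n (s - 1)) (m (s - 1)) (n s) (m s)"
    and d_pos: "m s > 0"
  shows
   "(let \<gamma> = n s; d = m s;
        l1 = (real (n s) - real (n (s - 1))) / (real (m (s - 1)) - real (m s));
        T = y_intercept (n (s - 1)) (m (s - 1)) (n s) (m s);
        c = (\<lambda>k. real (ord2 (Qn p q k)));
        g = (\<lambda>k. real (gamma_n \<gamma> \<delta> d k))
    in (l1 \<le> 1 \<longrightarrow> (\<forall>k\<ge>1. c k = g k + real d ^ k))
     \<and> (l1 > 1 \<longrightarrow> (\<forall>k\<ge>1. g k / l1 + real d ^ k \<le> c k \<and> c k < g k + real d ^ k))
     \<and> (l1 > 1 \<and> (n 1 > 0 \<or> s > 2) \<longrightarrow> (\<forall>k\<ge>1. g k / l1 + real d ^ k < c k))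
     \<and> (l1 > 1 \<and> n 1 = 0 \<and> s = 2 \<longrightarrow>
          (real \<delta> < T \<longrightarrow> real \<gamma> / l1 + real d = real (ord2 q)
                         \<and> (\<forall>k\<ge>2. g k / l1 + real d ^ k < c k))
        \<and> (real \<delta> = T \<longrightarrow> (\<forall>k\<ge>1. g k / l1 + real d ^ k = c k))))"
proof -
  define A where "A = n s - n (s - 1)"
  define B where "B = m (s - 1) - m s"
  define \<gamma> where "\<gamma> = n s"
  define d where "d = m s"
  define T where "T = y_intercept (n (s - 1)) (m (s - 1)) (n s) (m s)"
  define l where "l = (real (n s) - real (n (s - 1))) / (real (m (s - 1)) - real (m s))"
  define c where "c = (\<lambda>k. ord2 (Qn p q k))"
  define g where "g = gamma_n \<gamma> \<delta> d"
  \<comment> \<open>Rules out truncation in the natural subtractions defining \<open>A\<close> and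
    \<open>B\<close>.\<close>
  have lt: "n (s - 1) < n s" "m s < m (s - 1)"
    using n_mono[rule_format, of "s - 1"] m_mono[rule_format, of "s - 1"] case2(1) by auto
  then have A: "A + n (s - 1) = n s" "A > 0" and B: "B + m s = m (s - 1)" "B > 0"
    by (auto simp: A_def B_def)
  note leads = last_edge_leads[OF q_nonzero n_mono m_mono vertices case2(1) A(1) B(1)]
  have rA: "real (n s) - real (n (s - 1)) = real A" and rB: "real (m (s - 1)) - real (m s) = real B"
    using A(1) B(1) by (simp_all add: of_nat_add[symmetric] del: of_nat_add flip: A(1) B(1))
  have l: "l = real A / real B" unfolding l_def rA rB ..
  have edge: "B * n (s - 1) + A * m (s - 1) = B * \<gamma> + A * d"
  proof -
    have "B * \<gamma> + A * d = B * (A + n (s - 1)) + A * m s" by (simp only: A \<gamma>_def d_def)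
    also have "\<dots> = B * n (s - 1) + A * (B + m s)" by (simp add: algebra_simps)
    finally show ?thesis by (simp only: B)
  qed
  \<comment> \<open>The point \<open>(0, T)\<close> lies on the line of the last edge, so
    \<open>A * T\<close> is the common weight of the points on that line.\<close>
  have T: "real A * T = real (B * \<gamma> + A * d)"
  proof -
    have "real (m s) - real (m (s - 1)) = - real B" using rB by simp
    then have "T = real (m (s - 1)) + real B / real A * real (n (s - 1))"
      unfolding T_def y_intercept_def rA by simp
    then have "real A * T = real (B * n (s - 1) + A * m (s - 1))"
      using A(2) by (simp add: field_simps)
    then show ?thesis unfolding edge .
  qed
  have T_le: "real \<delta> \<le> T \<longleftrightarrow> A * \<delta> \<le> B * \<gamma> + A * d"
    and T_eq: "real \<delta> = T \<longleftrightarrow> A * \<delta> = B * \<gamma> + A * d"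
  proof -
    have "real \<delta> \<le> T \<longleftrightarrow> real A * real \<delta> \<le> real A * T" "real \<delta> = T \<longleftrightarrow> real A * real \<delta> = real A * T"
      using A(2) by simp_all
    then show "real \<delta> \<le> T \<longleftrightarrow> A * \<delta> \<le> B * \<gamma> + A * d" "real \<delta> = T \<longleftrightarrow> A * \<delta> = B * \<gamma> + A * d"
      unfolding T of_nat_mult[symmetric] of_nat_le_iff of_nat_eq_iff by blast+
  qed
  \<comment> \<open>\<open>D\<close> is \<open>A * (T - \<delta>)\<close>, a natural number by Case
    2.\<close>
  obtain D where D: "B * \<gamma> + A * d = A * \<delta> + D"
    using case2(2) T_le le_Suc_ex unfolding T_def by blast
  have T_less: "real \<delta> < T \<longleftrightarrow> D > 0" and T_eq': "real \<delta> = T \<longleftrightarrow> D = 0"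
    using T_le T_eq D case2(2)[folded T_def] by auto
  have l_le: "l \<le> 1 \<longleftrightarrow> A \<le> B" and l_gt: "l > 1 \<longleftrightarrow> B < A"
    using B(2) unfolding l by auto
  have bound: "real (g k) / l + real d ^ k = real (B * g k + A * d ^ k) / real A" for k
    using A(2) B(2) unfolding l by (simp add: field_simps)
  \<comment> \<open>All estimates in natural numbers, cleared of the denominator
    \<open>A\<close>.\<close>
  have main: "(A \<le> B \<longrightarrow> c k = g k + d ^ k) \<and>
      (B < A \<longrightarrow> B * g k + A * d ^ k \<le> A * c k \<and> c k < g k + d ^ k) \<and>
      (B < A \<and> (n (s - 1) > 0 \<or> D > 0 \<and> k \<ge> 2) \<longrightarrow> B * g k + A * d ^ k < A * c k) \<and>
      (B < A \<and> n (s - 1) = 0 \<and> (D = 0 \<or> k = 1) \<longrightarrow> B * g k + A * d ^ k = A * c k)" if k: "k \<ge> 1" for k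
  proof -
    have dpos: "d > 0" "d < m (s - 1)" "\<gamma> > 0" "\<delta> > 0"
      using d_pos lt \<delta>_pos by (auto simp: d_def \<gamma>_def)
    obtain C r I J where C: "expansion2 (Qn p q k) (curry C) r"
        "lead (lexw 0 1 1 0) C (g k, d ^ k)" "lead (lexw B A 0 1) C (g k, d ^ k)" "lead (lexw B A 1 0) C (I, J)"
        "B * I + A * J = B * g k + A * d ^ k" "d ^ k < J"
      and I: "n (s - 1) > 0 \<longrightarrow> I > 0" "D > 0 \<and> k \<ge> 2 \<longrightarrow> I > 0" "n (s - 1) = 0 \<and> (D = 0 \<or> k = 1) \<longrightarrow> I = 0"
      using Qn_leads[OF p_exp a_low a_\<delta> q_exp b00 dpos(4,1) A(2) B(2) dpos(2,3) D edge[unfolded D]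
          leads[folded \<gamma>_def d_def] k]
      unfolding g_def[symmetric] by (elim exE conjE) (rule that)
    show ?thesis
      using ord2_from_leads[OF C A(2) B(2)] I unfolding c_def by blast
  qed
  have cmp: "real (g k) / l + real d ^ k \<le> real (c k) \<longleftrightarrow> B * g k + A * d ^ k \<le> A * c k"
    "real (g k) / l + real d ^ k < real (c k) \<longleftrightarrow> B * g k + A * d ^ k < A * c k"
    "real (g k) / l + real d ^ k = real (c k) \<longleftrightarrow> B * g k + A * d ^ k = A * c k"
    "real (c k) < real (g k) + real d ^ k \<longleftrightarrow> c k < g k + d ^ k"
    "real (c k) = real (g k) + real d ^ k \<longleftrightarrow> c k = g k + d ^ k" for k
  proof -
    have x: "x / real A \<le> y \<longleftrightarrow> x \<le> real A * y" "x / real A < y \<longleftrightarrow> x < real A * y"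
      "x / real A = y \<longleftrightarrow> x = real A * y" for x y :: real
      using A(2) by (auto simp: field_simps)
    show "real (g k) / l + real d ^ k \<le> real (c k) \<longleftrightarrow> B * g k + A * d ^ k \<le> A * c k"
      "real (g k) / l + real d ^ k < real (c k) \<longleftrightarrow> B * g k + A * d ^ k < A * c k"
      "real (g k) / l + real d ^ k = real (c k) \<longleftrightarrow> B * g k + A * d ^ k = A * c k"
      unfolding bound x of_nat_mult[symmetric] of_nat_le_iff of_nat_less_iff of_nat_eq_iff by (rule refl)+
    show "real (c k) < real (g k) + real d ^ k \<longleftrightarrow> c k < g k + d ^ k"
      "real (c k) = real (g k) + real d ^ k \<longleftrightarrow> c k = g k + d ^ k"
      unfolding of_nat_power[symmetric] of_nat_add[symmetric] of_nat_less_iff of_nat_eq_iff by (rule refl)+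
  qed
  \<comment> \<open>For \<open>s > 2\<close> the vertex \<open>s - 1\<close> has a predecessor with
    smaller abscissa; for \<open>s = 2\<close> it is the first vertex.\<close>
  have npos: "n (s - 1) > 0" if "n 1 > 0 \<or> s > 2"
  proof (cases "s > 2")
    case True
    then have "n (s - 2) < n (Suc (s - 2))" "Suc (s - 2) = s - 1"
      using n_mono[rule_format, of "s - 2"] by auto
    then show ?thesis by simp
  next
    case False
    then have "s = 2" using case2(1) by simp
    then show ?thesis using that by simp
  qed
  have n0: "n (s - 1) = 0" if "n 1 = 0" "s = 2" using that by simp
  \<comment> \<open>Lets the equality for \<open>q\<close> itself be read off from
    \<open>main\<close> at \<open>k = 1\<close>.\<close>
  have one: "real (g 1) / l + real d ^ 1 = real \<gamma> / l + real d" "c 1 = ord2 q"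
    by (simp_all add: g_def c_def gamma_n_Suc_0 Qn_Suc_0)
  have "(l \<le> 1 \<longrightarrow> (\<forall>k\<ge>1. real (c k) = real (g k) + real d ^ k))
     \<and> (l > 1 \<longrightarrow> (\<forall>k\<ge>1. real (g k) / l + real d ^ k \<le> real (c k) \<and> real (c k) < real (g k) + real d ^ k))
     \<and> (l > 1 \<and> (n 1 > 0 \<or> s > 2) \<longrightarrow> (\<forall>k\<ge>1. real (g k) / l + real d ^ k < real (c k)))
     \<and> (l > 1 \<and> n 1 = 0 \<and> s = 2 \<longrightarrow>
          (real \<delta> < T \<longrightarrow> real (g 1) / l + real d ^ 1 = real (c 1)
                         \<and> (\<forall>k\<ge>2. real (g k) / l + real d ^ k < real (c k)))
        \<and> (real \<delta> = T \<longrightarrow> (\<forall>k\<ge>1. real (g k) / l + real d ^ k = real (c k))))"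
    unfolding cmp l_le l_gt T_less T_eq'
    using main main[of 1] npos n0 by auto
  then show ?thesis
    unfolding one Let_def by (simp only: l_def T_def c_def g_def \<gamma>_def d_def)
qed

end
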